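(* Let $1\le p\le q\le\infty$ and $r=2/(1/q-1/p+1)$. Then $\mathfrak{S}_r$ embeds contractively into $CB(H_{\min},H(\Phi_p,\Phi_q))$: every $A\in\mathfrak{S}_r$, regarded as a linear map $H\to H$, satisfies $\|A\|_{CB(H_{\min},H(\Phi_p,\Phi_q))}\le\|A\|_r$.
   Context: $H$ is a separable infinite-dimensional Hilbert space with orthonormal basis $(\xi_i)$. $\Phi_p$ is the $\ell_p$-norm, $\mathfrak{S}_p$ the Schatten class with norm $\|\cdot\|_p$. For finite $T=\sum_i\xi_i\otimes T_i\in H\otimes M_n$, $\rho_T(x)=\sum_iT_ixT_i^*$ and $\|T\|_{\Phi_p,\Phi_q}=\|\rho_T:\mathfrak{S}_p(\mathbb{C}^n)\to\mathfrak{S}_q(\mathbb{C}^n)\|^{1/2}$; $H(\Phi_p,\Phi_q)$ is $H$ with these matrix norms on $M_n(H)\cong H\otimes M_n$. $H_{\min}$ is $H$ with matrix norms $\|\sum_{i=1}^m\xi_i\otimes T_i\|_{\min}=\sup\{\|\sum_iv_iT_i\|:v\in\ell_2^m,\|v\|=1\}$. For linear $u$ between spaces with matrix norms, $\|u\|_{cb}=\sup_n\|\mathrm{id}_{M_n}\otimes u\|$, and $CB(E,F)$ is the space of $u$ with finite cb-norm. *)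

theory Defs
  imports "HOL-Analysis.Analysis" "Jordan_Normal_Form.Char_Poly"
begin

text \<open>Conventions. The separable Hilbert space H is represented in coordinates
w.r.t. the orthonormal basis (xi_i), i :: nat. An n x n complex matrix is a
function nat => nat => complex of which only the entries with indices < n matter.
A (bounded) linear map A on H is given by its matrix a i k = <A xi_k, xi_i>.
An element of H (x) M_n is a sequence T :: nat => matrix, T = sum_i xi_i (x) T_i.\<close>

type_synonym cmatrix = "nat \<Rightarrow> nat \<Rightarrow> complex"

definition mmul :: "nat \<Rightarrow> cmatrix \<Rightarrow> cmatrix \<Rightarrow> cmatrix" where
  "mmul n X Y = (\<lambda>i j. \<Sum>k<n. X i k * Y k j)"

definition madj :: "cmatrix \<Rightarrow> cmatrix" where
  "madj X = (\<lambda>i j. cnj (X j i))"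

definition vnorm :: "nat \<Rightarrow> (nat \<Rightarrow> complex) \<Rightarrow> real" where
  "vnorm n v = sqrt (\<Sum>i<n. (cmod (v i))\<^sup>2)"

definition opnorm :: "nat \<Rightarrow> cmatrix \<Rightarrow> real" where
  "opnorm n X = Sup (insert 0 {vnorm n (\<lambda>i. \<Sum>j<n. X i j * v j) | v. vnorm n v = 1})"

text \<open>Characteristic polynomial of X^* X (as a Jordan_Normal_Form matrix);
its roots, counted with multiplicity, are the squares of the singular values of X.\<close>
definition sv_poly :: "nat \<Rightarrow> cmatrix \<Rightarrow> complex poly" where
  "sv_poly n X = char_poly (mat n n (\<lambda>(i,j). mmul n (madj X) X i j))"

definition schatten :: "ereal \<Rightarrow> nat \<Rightarrow> cmatrix \<Rightarrow> real" where
  "schatten p n X = (if p = \<infinity> then opnorm n X else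
     (\<Sum>z\<in>{z. poly (sv_poly n X) z = 0}.
        real (order z (sv_poly n X)) * (sqrt (cmod z)) powr (real_of_ereal p))
       powr (1 / real_of_ereal p))"

definition rho :: "nat \<Rightarrow> nat \<Rightarrow> (nat \<Rightarrow> cmatrix) \<Rightarrow> cmatrix \<Rightarrow> cmatrix" where
  "rho n m T x = (\<lambda>i j. \<Sum>k<m. mmul n (mmul n (T k) x) (madj (T k)) i j)"

definition pq_sq_trunc :: "ereal \<Rightarrow> ereal \<Rightarrow> nat \<Rightarrow> nat \<Rightarrow> (nat \<Rightarrow> cmatrix) \<Rightarrow> ereal" where
  "pq_sq_trunc p q n m T =
     (SUP x \<in> {x. schatten p n x \<le> 1}. ereal (schatten q n (rho n m T x)))"

definition pq_norm :: "ereal \<Rightarrow> ereal \<Rightarrow> nat \<Rightarrow> (nat \<Rightarrow> cmatrix) \<Rightarrow> ereal" where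
  "pq_norm p q n T = (let s = (SUP m. pq_sq_trunc p q n m T) in
     if s = \<infinity> then \<infinity> else ereal (sqrt (real_of_ereal s)))"

definition min_norm :: "nat \<Rightarrow> (nat \<Rightarrow> cmatrix) \<Rightarrow> ereal" where
  "min_norm n T = (SUP m. SUP v \<in> {v. vnorm m v = 1}.
       ereal (opnorm n (\<lambda>i j. \<Sum>k<m. v k * T k i j)))"

definition fin_supp :: "(nat \<Rightarrow> cmatrix) \<Rightarrow> bool" where
  "fin_supp T = finite {k. T k \<noteq> (\<lambda>i j. 0)}"

text \<open>(id_{M_n} (x) A) applied to a finitely supported T: sum_i xi_i (x) (sum_k a_ik T_k).\<close>
definition op_apply :: "cmatrix \<Rightarrow> (nat \<Rightarrow> cmatrix) \<Rightarrow> (nat \<Rightarrow> cmatrix)" where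
  "op_apply a T = (\<lambda>i. \<lambda>r c. \<Sum>k\<in>{k. T k \<noteq> (\<lambda>i j. 0)}. a i k * T k r c)"

definition cb_norm_min_pq :: "ereal \<Rightarrow> ereal \<Rightarrow> cmatrix \<Rightarrow> ereal" where
  "cb_norm_min_pq p q a = (SUP (n, T) \<in> {(n, T). fin_supp T \<and> min_norm n T \<noteq> 0}.
       pq_norm p q n (op_apply a T) / min_norm n T)"

text \<open>Schatten r-norm of an operator on H, via the finite sections P_N A P_N.\<close>
definition op_schatten :: "ereal \<Rightarrow> cmatrix \<Rightarrow> ereal" where
  "op_schatten r a = (SUP N. ereal (schatten r N a))"

text \<open>Membership in S_r (for r = infinity: compact operators).\<close>
definition in_schatten :: "ereal \<Rightarrow> cmatrix \<Rightarrow> bool" where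
  "in_schatten r a = (op_schatten r a < \<infinity> \<and>
     (r = \<infinity> \<longrightarrow> ((\<lambda>N. op_schatten \<infinity> (\<lambda>i j. if i < N \<and> j < N then 0 else a i j))
                     \<longlonglongrightarrow> 0)))"

definition ereal_inv :: "ereal \<Rightarrow> real" where
  "ereal_inv p = (if p = \<infinity> then 0 else 1 / real_of_ereal p)"

definition r_exp :: "ereal \<Rightarrow> ereal \<Rightarrow> ereal" where
  "r_exp p q = (let d = ereal_inv q - ereal_inv p + 1 in
     if d = 0 then \<infinity> else ereal (2 / d))"

end

theory Submission
  imports Defs "Jordan_Normal_Form.Schur_Decomposition" "HOL-Computational_Algebra.Fundamental_Theorem_Algebra"
begin

text \<open>Let \<open>d\<close>, \<open>\<xi>\<close>, \<open>s\<close> be the singular values of a finite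
section of \<open>A\<close>, of \<open>x\<close>, and of the image of \<open>x\<close> under \<open>rho\<close>. Write \<open>t\<close> for the trilinear form
\<open>t v u y = (\<Sum>b. v b * \<langle>T b u, cnj y\<rangle>)\<close>, which the norm on \<open>H\<^sub>m\<^sub>i\<^sub>n\<close> bounds by
\<open>c \<parallel>v\<parallel> \<parallel>u\<parallel> \<parallel>y\<parallel>\<close>. Expanding everything in singular vectors and using \<open>2 |z w| \<le> |z|\<^sup>2 + |w|\<^sup>2\<close>
gives \<open>s k \<le> (\<Sum>l j. (d l)\<^sup>2 * \<xi> j * K l j k)\<close>, where \<open>K\<close> averages two kernels \<open>|t (G l) (U j) (P k)|\<^sup>2\<close>.
By Bessel's inequality the sum of \<open>K\<close> over any one of its three indices is at most \<open>c\<^sup>2\<close>.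
Pairing with \<open>Y\<close> in the unit ball dual to \<open>\<ell>\<^sub>q\<close>, the exponents satisfy \<open>2/r + 1/p + (1 - 1/q) = 2\<close>,
and the weighted arithmetic-geometric mean inequality reduces the trilinear sum to the three partial sums of \<open>K\<close>.\<close>

subsection \<open>Unitary diagonalization of Hermitian matrices\<close>

definition mat_adj :: "complex mat \<Rightarrow> complex mat" where
  "mat_adj A = transpose_mat (map_mat cnj A)"

lemma mat_adj_carrier [simp]: "A \<in> carrier_mat n m \<Longrightarrow> mat_adj A \<in> carrier_mat m n"
  by (simp add: mat_adj_def)

lemma mat_adj_dim [simp]: "dim_row (mat_adj A) = dim_col A" "dim_col (mat_adj A) = dim_row A"
  by (simp_all add: mat_adj_def)

lemma mat_adj_index [simp]:
  "i < dim_col A \<Longrightarrow> j < dim_row A \<Longrightarrow> mat_adj A $$ (i,j) = cnj (A $$ (j,i))"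
  by (simp add: mat_adj_def)

lemma mat_adj_adj [simp]: "mat_adj (mat_adj A) = A"
  by (rule eq_matI) simp_all

lemma mat_adj_mult:
  assumes "A \<in> carrier_mat n k" "B \<in> carrier_mat k m"
  shows "mat_adj (A * B) = mat_adj B * mat_adj A"
  by (rule eq_matI) (use assms in \<open>auto simp: scalar_prod_def mult.commute intro!: sum.cong\<close>)

lemma mat_adj_four_block:
  assumes "A \<in> carrier_mat n1 m1" "B \<in> carrier_mat n1 m2" "C \<in> carrier_mat n2 m1" "D \<in> carrier_mat n2 m2"
  shows "mat_adj (four_block_mat A B C D) = four_block_mat (mat_adj A) (mat_adj C) (mat_adj B) (mat_adj D)"
  by (rule eq_matI) (use assms in auto)

lemma mat_adj_one [simp]: "mat_adj (1\<^sub>m n) = 1\<^sub>m n"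
  by (rule eq_matI) auto

lemma mat_adj_zero [simp]: "mat_adj (0\<^sub>m n m) = 0\<^sub>m m n"
  by (rule eq_matI) auto

text \<open>Deflation step for the induction below. \<open>gram_schmidt\<close> keeps the head of
  the completed basis, so its first vector is still \<open>v\<close>. Its output is orthogonal but
  not normalized, hence the division of each column by its length \<open>sqrt (N j)\<close>.\<close>

lemma unitary_with_first_col:
  fixes v :: "complex Matrix.vec"
  assumes v: "v \<in> carrier_vec n" and v0: "v \<noteq> 0\<^sub>v n"
  shows "\<exists>U c. U \<in> carrier_mat n n \<and> mat_adj U * U = 1\<^sub>m n \<and> col U 0 = c \<cdot>\<^sub>v v"
proof -
  interpret cof_vec_space n "TYPE(complex)" .
  define ws where "ws = gram_schmidt n (basis_completion v)"
  note b = basis_completion[OF v v0]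
  have ws: "set ws \<subseteq> carrier_vec n" "corthogonal ws" "length ws = n"
    using gram_schmidt_result[OF b(2) b(4) b(5) ws_def] b(6) by auto
  have n0: "n > 0" using v v0 by (cases n) auto
  have "basis_completion v = v # tl (basis_completion v)"
    using b(6,7) n0 by (cases "basis_completion v") auto
  then have hd: "ws ! 0 = v"
    using gram_schmidt_hd[OF v, of "tl (basis_completion v)"] ws(3) n0 hd_conv_nth[of ws]
    by (metis length_0_conv less_numeral_extra(3) ws_def)
  define N where "N = (\<lambda>j. \<Sum>i<n. (cmod (ws ! j $ i))\<^sup>2)"
  have ip: "ws ! i \<bullet>c ws ! j = (\<Sum>k<n. ws ! i $ k * cnj (ws ! j $ k))" if "i < n" "j < n" for i j
  proof -
    have "ws ! j \<in> carrier_vec n" using ws that by auto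
    then show ?thesis by (auto simp: scalar_prod_def lessThan_atLeast0)
  qed
  have self: "(\<Sum>k<n. ws ! j $ k * cnj (ws ! j $ k)) = complex_of_real (N j)" for j
    unfolding N_def of_real_sum by (intro sum.cong) (simp_all only: complex_norm_square)
  have Npos: "N j > 0" if "j < n" for j
  proof -
    have "N j \<noteq> 0" using corthogonalD[OF ws(2), of j j] ip[OF that that] self[of j] that ws(3) by auto
    moreover have "N j \<ge> 0" unfolding N_def by (intro sum_nonneg) auto
    ultimately show ?thesis by simp
  qed
  define U where "U = mat n n (\<lambda>(i,j). complex_of_real (1 / sqrt (N j)) * ws ! j $ i)"
  have U: "U \<in> carrier_mat n n" by (simp add: U_def)
  have "mat_adj U * U = 1\<^sub>m n"
  proof (rule eq_matI; simp only: index_one_mat)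
    fix i j assume ij: "i < n" "j < n"
    have "(mat_adj U * U) $$ (i,j)
      = complex_of_real (1 / sqrt (N i)) * complex_of_real (1 / sqrt (N j)) * (\<Sum>k<n. ws ! j $ k * cnj (ws ! i $ k))"
      using ij by (simp add: U_def scalar_prod_def sum_distrib_left lessThan_atLeast0 mult_ac)
    also have "\<dots> = (if i = j then 1 else 0)"
    proof (cases "i = j")
      case True
      have "complex_of_real (1 / sqrt (N j)) * complex_of_real (1 / sqrt (N j)) * complex_of_real (N j)
        = complex_of_real (N j / (sqrt (N j) * sqrt (N j)))"
        by (simp only: of_real_mult [symmetric]) simp
      also have "\<dots> = 1" using Npos[OF ij(2)] by simp
      finally show ?thesis unfolding True self by simp
    next
      case False
      then show ?thesis using ip[OF ij(2,1)] corthogonalD[OF ws(2), of j i] ij ws(3) by auto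
    qed
    finally show "(mat_adj U * U) $$ (i, j) = (if i = j then 1 else 0)" .
  qed (use U in auto)
  moreover have "col U 0 = complex_of_real (1 / sqrt (N 0)) \<cdot>\<^sub>v v"
    by (rule eq_vecI) (use n0 v in \<open>auto simp: U_def hd\<close>)
  ultimately show ?thesis using U by blast
qed

text \<open>Induction on the dimension. An eigenvector becomes, up to a scalar, the first column of
  a unitary \<open>U\<close>, so the first column of \<open>B\<close> is zero below the diagonal. As
  \<open>B\<close> is Hermitian, its first row vanishes off the diagonal too, and the induction
  hypothesis applies to the remaining block \<open>C\<close>.\<close>

lemma hermitian_diagonalization:
  assumes "A \<in> carrier_mat n n" "mat_adj A = A"
  shows "\<exists>U D. U \<in> carrier_mat n n \<and> D \<in> carrier_mat n n \<and> mat_adj U * U = 1\<^sub>m n \<and>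
    mat_adj U * A * U = D \<and> diagonal_mat D"
  using assms
proof (induction n arbitrary: A)
  case 0
  then show ?case
    by (intro exI[of _ "1\<^sub>m 0"] exI[of _ A]) (auto simp: diagonal_mat_def)
next
  case (Suc n)
  note A = Suc.prems(1)
  have "degree (char_poly A) = Suc n" using degree_monic_char_poly[OF A] by simp
  then obtain e where "poly (char_poly A) e = 0"
    using fundamental_theorem_of_algebra[of "char_poly A"] by (auto simp: constant_degree)
  then have "eigenvalue A e" using eigenvalue_root_char_poly[OF A] by simp
  then obtain v where v: "v \<in> carrier_vec (Suc n)" "v \<noteq> 0\<^sub>v (Suc n)" "A *\<^sub>v v = e \<cdot>\<^sub>v v"
    using A unfolding eigenvalue_def eigenvector_def by auto
  obtain U c where U: "U \<in> carrier_mat (Suc n) (Suc n)" "mat_adj U * U = 1\<^sub>m (Suc n)"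
    and c: "col U 0 = c \<cdot>\<^sub>v v"
    using unitary_with_first_col[OF v(1,2)] by blast
  define B where "B = mat_adj U * A * U"
  have B: "B \<in> carrier_mat (Suc n) (Suc n)"
    unfolding B_def using A U(1) by (intro mult_carrier_mat[of _ "Suc n" "Suc n"]) simp_all
  have Bh: "mat_adj B = B"
    unfolding B_def using A U(1) Suc.prems(2)
    by (simp add: mat_adj_mult[of _ "Suc n" "Suc n" _ "Suc n"] assoc_mult_mat[of _ "Suc n" "Suc n" _ "Suc n" _ "Suc n"])
  have B0: "B $$ (i,0) = (if i = 0 then e else 0)" if "i < Suc n" for i
  proof -
    have "A *\<^sub>v col U 0 = e \<cdot>\<^sub>v col U 0"
      using A v c by (auto simp: mult_mat_vec smult_smult_assoc mult.commute)
    then have "col (A * U) 0 = e \<cdot>\<^sub>v col U 0" using col_mult2[OF A U(1), of 0] by simp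
    then have "(mat_adj U * (A * U)) $$ (i,0) = row (mat_adj U) i \<bullet> (e \<cdot>\<^sub>v col U 0)"
      using A U that by simp
    also have "\<dots> = e * (mat_adj U * U) $$ (i,0)"
      using U(1) that by simp
    also have "\<dots> = (if i = 0 then e else 0)" using U(2) that by simp
    finally show ?thesis using A U by (simp add: B_def assoc_mult_mat[of _ "Suc n" "Suc n" _ "Suc n" _ "Suc n"])
  qed
  define E where "E = mat 1 1 (\<lambda>_. e)"
  define C where "C = mat n n (\<lambda>(i,j). B $$ (Suc i, Suc j))"
  have E: "E \<in> carrier_mat 1 1" and C: "C \<in> carrier_mat n n" by (simp_all add: E_def C_def)
  have Bij: "B $$ (i,j) = cnj (B $$ (j,i))" if "i < Suc n" "j < Suc n" for i j
    using arg_cong[OF Bh, of "\<lambda>M. M $$ (i,j)"] B that by simp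
  have B_block: "B = four_block_mat E (0\<^sub>m 1 n) (0\<^sub>m n 1) C"
  proof (rule eq_matI)
    fix i j assume "i < dim_row (four_block_mat E (0\<^sub>m 1 n) (0\<^sub>m n 1) C)" "j < dim_col (four_block_mat E (0\<^sub>m 1 n) (0\<^sub>m n 1) C)"
    then have ij: "i < Suc n" "j < Suc n" using E C by auto
    show "B $$ (i,j) = four_block_mat E (0\<^sub>m 1 n) (0\<^sub>m n 1) C $$ (i,j)"
      using ij E C B0[of i] B0[of j] Bij[of 0 j]
      by (auto simp: E_def C_def split: if_splits)
  qed (use B E C in auto)
  have "mat_adj C = C"
    by (rule eq_matI) (auto simp: C_def Bij [symmetric])
  from Suc.IH[OF C this] obtain V D where V: "V \<in> carrier_mat n n" "mat_adj V * V = 1\<^sub>m n"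
    and D: "D \<in> carrier_mat n n" "mat_adj V * C * V = D" "diagonal_mat D" by blast
  \<comment> \<open>The unitary \<open>V\<close> of the smaller block is padded by a 1 so that the
    first coordinate stays fixed; \<open>U * W\<close> is then the required unitary.\<close>
  define W where "W = four_block_mat (1\<^sub>m 1) (0\<^sub>m 1 n) (0\<^sub>m n 1) V"
  have W: "W \<in> carrier_mat (Suc n) (Suc n)" using V by (intro carrier_matI) (simp_all add: W_def)
  have Wa: "mat_adj W = four_block_mat (1\<^sub>m 1) (0\<^sub>m 1 n) (0\<^sub>m n 1) (mat_adj V)"
    unfolding W_def by (subst mat_adj_four_block[of _ 1 1 _ n _ n]) (use V in auto)
  have WW: "mat_adj W * W = 1\<^sub>m (Suc n)"
    unfolding Wa unfolding W_def by (subst mult_four_block_mat[of _ 1 1 _ n _ n _ _ 1 _ n]) (use V in auto)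
  have WBW: "mat_adj W * B * W = four_block_mat E (0\<^sub>m 1 n) (0\<^sub>m n 1) D"
  proof -
    have "mat_adj W * B = four_block_mat E (0\<^sub>m 1 n) (0\<^sub>m n 1) (mat_adj V * C)"
      unfolding Wa B_block by (subst mult_four_block_mat[of _ 1 1 _ n _ n _ _ 1 _ n]) (use V E C in auto)
    moreover have "four_block_mat E (0\<^sub>m 1 n) (0\<^sub>m n 1) (mat_adj V * C) * W =
      four_block_mat E (0\<^sub>m 1 n) (0\<^sub>m n 1) D"
      unfolding W_def by (subst mult_four_block_mat[of _ 1 1 _ n _ n _ _ 1 _ n])
        (use V(1) E C D(1) in \<open>simp_all add: D(2) mult_carrier_mat[of _ n n _ n]\<close>)
    ultimately show ?thesis by simp
  qed
  have dia: "diagonal_mat (four_block_mat E (0\<^sub>m 1 n) (0\<^sub>m n 1) D)"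
    using D E unfolding diagonal_mat_def by auto
  have UW: "mat_adj (U * W) = mat_adj W * mat_adj U" using mat_adj_mult U W by blast
  note as = assoc_mult_mat[of _ "Suc n" "Suc n" _ "Suc n" _ "Suc n"]
  have "mat_adj (U * W) * (U * W) = mat_adj W * ((mat_adj U * U) * W)"
    unfolding UW using U(1) W
    by (simp add: as mult_carrier_mat[of _ "Suc n" "Suc n" _ "Suc n"])
  then have 1: "mat_adj (U * W) * (U * W) = 1\<^sub>m (Suc n)" using U W WW by simp
  have 2: "mat_adj (U * W) * A * (U * W) = four_block_mat E (0\<^sub>m 1 n) (0\<^sub>m n 1) D"
    unfolding UW WBW[symmetric] B_def using U(1) W A
    by (simp add: as mult_carrier_mat[of _ "Suc n" "Suc n" _ "Suc n"])
  show ?case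
    using 1 2 dia U(1) W E D(1) by (intro exI[of _ "U * W"] exI[of _ "four_block_mat E (0\<^sub>m 1 n) (0\<^sub>m n 1) D"]) auto
qed

subsection \<open>Contractive families\<close>

lemma vnorm_eq_L2: "vnorm n v = L2_set (\<lambda>i. cmod (v i)) {..<n}"
  by (simp add: vnorm_def L2_set_def)

lemma vnorm_nonneg [simp]: "vnorm n v \<ge> 0"
  by (simp add: vnorm_def sum_nonneg)

lemma vnorm_sq: "(vnorm n v)\<^sup>2 = (\<Sum>i<n. (cmod (v i))\<^sup>2)"
  by (simp add: vnorm_def sum_nonneg)

lemma vnorm_sq_complex: "complex_of_real ((vnorm n v)\<^sup>2) = (\<Sum>i<n. v i * cnj (v i))"
  unfolding vnorm_sq of_real_sum by (intro sum.cong) (simp_all only: complex_norm_square)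

lemma vnorm_scale: "vnorm n (\<lambda>i. c * v i) = cmod c * vnorm n v"
  by (simp add: vnorm_def norm_mult power_mult_distrib real_sqrt_mult flip: sum_distrib_left)

lemma vnorm_cnj [simp]: "vnorm n (\<lambda>i. cnj (v i)) = vnorm n v"
  by (simp add: vnorm_def)

lemma vnorm_Cauchy_Schwarz: "cmod (\<Sum>i<n. u i * v i) \<le> vnorm n u * vnorm n v"
proof -
  have "cmod (\<Sum>i<n. u i * v i) \<le> (\<Sum>i<n. \<bar>cmod (u i)\<bar> * \<bar>cmod (v i)\<bar>)"
    by (rule sum_norm_le) (simp add: norm_mult)
  also have "\<dots> \<le> vnorm n u * vnorm n v"
    unfolding vnorm_eq_L2 by (rule L2_set_mult_ineq)
  finally show ?thesis .
qed

text \<open>Orthonormal families have this property, and it survives replacing some members by 0, as needed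
  for the singular vectors of the singular value 0.\<close>
definition contractive_family :: "nat \<Rightarrow> cmatrix \<Rightarrow> bool" where
  "contractive_family n U \<longleftrightarrow> (\<forall>c. vnorm n (\<lambda>i. \<Sum>k<n. c k * U k i) \<le> vnorm n c)"

lemma contractive_family_cnj:
  assumes "contractive_family n U"
  shows "contractive_family n (\<lambda>k i. cnj (U k i))"
  unfolding contractive_family_def
proof
  fix c
  have "vnorm n (\<lambda>i. \<Sum>k<n. cnj (c k) * U k i) \<le> vnorm n (\<lambda>k. cnj (c k))"
    using assms unfolding contractive_family_def by (rule spec)
  also have "vnorm n (\<lambda>i. \<Sum>k<n. cnj (c k) * U k i) = vnorm n (\<lambda>i. cnj (\<Sum>k<n. cnj (c k) * U k i))"
    by (rule vnorm_cnj [symmetric])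
  also have "(\<lambda>i. cnj (\<Sum>k<n. cnj (c k) * U k i)) = (\<lambda>i. \<Sum>k<n. c k * cnj (U k i))"
    by (simp add: cnj_sum)
  finally show "vnorm n (\<lambda>i. \<Sum>k<n. c k * cnj (U k i)) \<le> vnorm n c" by simp
qed

lemma contractive_family_member:
  assumes "contractive_family n U" "k < n"
  shows "vnorm n (U k) \<le> 1"
proof -
  have "vnorm n (\<lambda>i. \<Sum>l<n. (if l = k then 1 else 0) * U l i) \<le> vnorm n (\<lambda>l. if l = k then 1 else 0)"
    using assms(1) unfolding contractive_family_def by (rule spec)
  moreover have "(\<lambda>i. \<Sum>l<n. (if l = k then 1 else 0) * U l i) = U k"
  proof
    fix i
    have "(\<Sum>l<n. (if l = k then 1 else 0) * U l i) = (\<Sum>l<n. if l = k then U l i else 0)"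
      by (intro sum.cong) auto
    then show "(\<Sum>l<n. (if l = k then 1 else 0) * U l i) = U k i" using assms(2) by simp
  qed
  moreover have "vnorm n (\<lambda>l. if l = k then 1 else 0) = 1"
    using assms(2) by (simp add: vnorm_def if_distrib[of cmod] if_distrib[of "\<lambda>x. x\<^sup>2"] cong: if_cong)
  ultimately show ?thesis by simp
qed

text \<open>Test the functional on the combination of the \<open>Z k\<close> whose coefficients are the conjugated values.\<close>
lemma contractive_family_functional:
  assumes Z: "contractive_family n Z" and C: "C \<ge> 0"
    and \<phi>: "\<And>z. cmod (\<Sum>i<n. \<phi> i * z i) \<le> C * vnorm n z"
  shows "(\<Sum>k<n. (cmod (\<Sum>i<n. \<phi> i * Z k i))\<^sup>2) \<le> C\<^sup>2"
proof -
  define f where "f = (\<lambda>k. \<Sum>i<n. \<phi> i * Z k i)"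
  define z where "z = (\<lambda>i. \<Sum>k<n. cnj (f k) * Z k i)"
  have "vnorm n z \<le> vnorm n (\<lambda>k. cnj (f k))"
    using Z unfolding contractive_family_def z_def by (rule spec)
  then have z: "vnorm n z \<le> vnorm n f" by simp
  have "(\<Sum>i<n. \<phi> i * z i) = (\<Sum>k<n. cnj (f k) * f k)"
    unfolding z_def f_def sum_distrib_left sum_distrib_right
    by (subst sum.swap) (simp add: mult_ac)
  also have "\<dots> = complex_of_real ((vnorm n f)\<^sup>2)"
    unfolding vnorm_sq_complex by (simp only: mult.commute)
  finally have "cmod (\<Sum>i<n. \<phi> i * z i) = (vnorm n f)\<^sup>2" by (simp add: norm_power)
  with \<phi>[of z] have "(vnorm n f)\<^sup>2 \<le> C * vnorm n z" by simp
  also have "\<dots> \<le> C * vnorm n f" using z C by (rule mult_left_mono)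
  finally have "vnorm n f * vnorm n f \<le> C * vnorm n f" by (simp add: power2_eq_square)
  then have "vnorm n f \<le> C"
    using C vnorm_nonneg[of n f] by (cases "vnorm n f = 0") auto
  then have "(vnorm n f)\<^sup>2 \<le> C\<^sup>2" by (rule power_mono) simp
  then show ?thesis by (simp add: vnorm_sq f_def)
qed

text \<open>The functional is the pairing with \<open>v\<close>, whose norm is at most
  \<open>vnorm n v\<close> by Cauchy-Schwarz.\<close>

lemma contractive_family_Bessel:
  assumes "contractive_family n Z"
  shows "(\<Sum>k<n. (cmod (\<Sum>i<n. v i * Z k i))\<^sup>2) \<le> (vnorm n v)\<^sup>2"
  using assms by (rule contractive_family_functional) (simp_all add: vnorm_Cauchy_Schwarz)

lemma contractive_familyI:
  assumes orth: "\<And>k l. k < n \<Longrightarrow> l < n \<Longrightarrow>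
      (\<Sum>i<n. U k i * cnj (U l i)) = (if k = l then complex_of_real (\<epsilon> k) else 0)"
    and \<epsilon>: "\<And>k. k < n \<Longrightarrow> \<epsilon> k \<le> 1"
  shows "contractive_family n U"
  unfolding contractive_family_def
proof
  fix c
  define w where "w = (\<lambda>i. \<Sum>k<n. c k * U k i)"
  have "complex_of_real ((vnorm n w)\<^sup>2) = (\<Sum>i<n. w i * cnj (w i))"
    by (rule vnorm_sq_complex)
  also have "\<dots> = (\<Sum>i<n. \<Sum>k<n. \<Sum>l<n. c k * cnj (c l) * (U k i * cnj (U l i)))"
    unfolding w_def by (simp add: cnj_sum sum_product mult_ac)
  also have "\<dots> = (\<Sum>k<n. \<Sum>l<n. \<Sum>i<n. c k * cnj (c l) * (U k i * cnj (U l i)))"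
    by (subst sum.swap) (intro sum.cong refl sum.swap)
  also have "\<dots> = (\<Sum>k<n. \<Sum>l<n. c k * cnj (c l) * (if k = l then complex_of_real (\<epsilon> k) else 0))"
    by (intro sum.cong refl) (simp add: orth flip: sum_distrib_left)
  also have "\<dots> = (\<Sum>k<n. c k * cnj (c k) * complex_of_real (\<epsilon> k))"
    by (intro sum.cong refl) (simp add: if_distrib[of "\<lambda>x. _ * x"] cong: if_cong)
  also have "\<dots> = complex_of_real (\<Sum>k<n. (cmod (c k))\<^sup>2 * \<epsilon> k)"
    unfolding of_real_sum of_real_mult by (intro sum.cong refl) (simp only: complex_norm_square)
  finally have "(vnorm n w)\<^sup>2 = (\<Sum>k<n. (cmod (c k))\<^sup>2 * \<epsilon> k)" by (simp only: of_real_eq_iff)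
  also have "\<dots> \<le> (\<Sum>k<n. (cmod (c k))\<^sup>2)"
    by (intro sum_mono mult_left_le) (use \<epsilon> in auto)
  finally have "(vnorm n w)\<^sup>2 \<le> (vnorm n c)\<^sup>2" by (simp add: vnorm_sq)
  then show "vnorm n (\<lambda>i. \<Sum>k<n. c k * U k i) \<le> vnorm n c"
    unfolding w_def by (rule power2_le_imp_le) simp
qed

text \<open>The order of a root \<open>z\<close> is the number of indices \<open>j\<close> with
  \<open>\<mu> j = z\<close>, so counting roots with multiplicity amounts to summing over indices.
  This turns the definition of \<open>schatten\<close> into a sum over singular values.\<close>

lemma sum_order_prod_linear:
  fixes n :: nat and \<mu> :: "nat \<Rightarrow> complex" and g :: "complex \<Rightarrow> real"
  defines "P \<equiv> \<Prod>j<n. [:- \<mu> j, 1:]"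
  shows "(\<Sum>z\<in>{z. poly P z = 0}. real (Polynomial.order z P) * g z) = (\<Sum>j<n. g (\<mu> j))"
proof -
  have P0: "P \<noteq> 0" unfolding P_def by simp
  \<comment> \<open>Stated for every number \<open>m\<close> of factors, not only for the fixed
    \<open>n\<close> in \<open>P\<close>, so that the induction goes through.\<close>
  have ord: "Polynomial.order z (\<Prod>j<m. [:- \<mu> j, 1:]) = (\<Sum>j<m. if \<mu> j = z then 1 else 0)" for z m
  proof (induction m)
    case 0
    show ?case by (simp add: order_0I)
  next
    case (Suc m)
    have "(\<Prod>j<m. [:- \<mu> j, 1:]) * [:- \<mu> m, 1:] \<noteq> 0"
      by (simp del: mult_pCons_right mult_pCons_left)
    then have "Polynomial.order z (\<Prod>j<Suc m. [:- \<mu> j, 1:]) = Polynomial.order z (\<Prod>j<m. [:- \<mu> j, 1:]) + Polynomial.order z [:- \<mu> m, 1:]"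
      unfolding prod.lessThan_Suc by (rule order_mult)
    also have "Polynomial.order z [:- \<mu> m, 1:] = (if \<mu> m = z then 1 else 0)"
      using order_power_n_n[of z 1] by (auto simp: order_0I)
    finally show ?case using Suc.IH by simp
  qed
  have R: "{z. poly P z = 0} = \<mu> ` {..<n}"
    unfolding P_def by (auto simp: poly_prod prod_zero_iff)
  have "(\<Sum>z\<in>{z. poly P z = 0}. real (Polynomial.order z P) * g z)
    = (\<Sum>z\<in>\<mu> ` {..<n}. \<Sum>j<n. if \<mu> j = z then g z else 0)"
    unfolding R unfolding P_def ord of_nat_sum sum_distrib_right by (intro sum.cong refl) auto
  also have "\<dots> = (\<Sum>j<n. \<Sum>z\<in>\<mu> ` {..<n}. if \<mu> j = z then g z else 0)" by (rule sum.swap)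
  also have "\<dots> = (\<Sum>j<n. g (\<mu> j))" by (intro sum.cong refl) simp
  finally show ?thesis .
qed

subsection \<open>Singular values\<close>

text \<open>The vectors are only required to form contractive families, so that those belonging to
  \<open>s j = 0\<close> may be 0. The expansion of \<open>X\<close> then does not by itself yield
  \<open>s j\<close> as a coefficient of \<open>X\<close>, hence the last clause.\<close>

definition is_svd :: "nat \<Rightarrow> cmatrix \<Rightarrow> cmatrix \<Rightarrow> (nat \<Rightarrow> real) \<Rightarrow> cmatrix \<Rightarrow> bool" where
  "is_svd n X U s V \<longleftrightarrow> contractive_family n U \<and> contractive_family n V \<and> (\<forall>j. s j \<ge> 0) \<and>
     (\<forall>i<n. \<forall>k<n. X i k = (\<Sum>j<n. complex_of_real (s j) * U j i * cnj (V j k))) \<and>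
     (\<forall>j<n. complex_of_real (s j) = (\<Sum>i<n. \<Sum>k<n. cnj (U j i) * X i k * V j k))"

text \<open>The \<open>V j\<close> are the columns of a unitary diagonalizing \<open>X^* X\<close>;
  unitarity from both sides gives orthonormality and completeness. The entry \<open>(l,j)\<close> of
  the diagonalized matrix is the inner product of the images of \<open>V j\<close> and
  \<open>V l\<close> under \<open>X\<close>, so these images are orthogonal. Similarity preserves
  the characteristic polynomial.\<close>

lemma gram_diagonalization:
  obtains V d where
    "\<And>j l. j < n \<Longrightarrow> l < n \<Longrightarrow> (\<Sum>i<n. V j i * cnj (V l i)) = (if j = l then 1 else 0)"
    "\<And>i k. i < n \<Longrightarrow> k < n \<Longrightarrow> (\<Sum>j<n. V j i * cnj (V j k)) = (if i = k then 1 else 0)"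
    "\<And>j l. j < n \<Longrightarrow> l < n \<Longrightarrow>
      (\<Sum>i<n. (\<Sum>k<n. X i k * V j k) * cnj (\<Sum>k<n. X i k * V l k)) = (if j = l then d j else 0)"
    "sv_poly n X = (\<Prod>j<n. [:- d j, 1:])"
proof -
  define A where "A = mat n n (\<lambda>(i,j). mmul n (madj X) X i j)"
  have A: "A \<in> carrier_mat n n" by (simp add: A_def)
  have "mat_adj A = A"
    by (rule eq_matI) (auto simp: A_def mmul_def madj_def cnj_sum mult.commute)
  with hermitian_diagonalization[OF A] obtain M D where M: "M \<in> carrier_mat n n" "mat_adj M * M = 1\<^sub>m n"
    and D: "D \<in> carrier_mat n n" "mat_adj M * A * M = D" "diagonal_mat D" by blast
  have M': "M * mat_adj M = 1\<^sub>m n"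
    using mat_mult_left_right_inverse[of "mat_adj M" n M] M by simp
  define V where "V = (\<lambda>j i. M $$ (i,j))"
  define d where "d = (\<lambda>j. D $$ (j,j))"
  have 1: "(\<Sum>i<n. V j i * cnj (V l i)) = (if j = l then 1 else 0)" if "j < n" "l < n" for j l
  proof -
    have "(mat_adj M * M) $$ (l,j) = (\<Sum>i<n. V j i * cnj (V l i))"
      using M(1) that by (simp add: V_def scalar_prod_def lessThan_atLeast0 mult.commute)
    then show ?thesis using M(2) that by auto
  qed
  have 2: "(\<Sum>j<n. V j i * cnj (V j k)) = (if i = k then 1 else 0)" if "i < n" "k < n" for i k
  proof -
    have "(M * mat_adj M) $$ (i,k) = (\<Sum>j<n. V j i * cnj (V j k))"
      using M(1) that by (simp add: V_def scalar_prod_def lessThan_atLeast0)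
    then show ?thesis using M' that by auto
  qed
  have 3: "(\<Sum>i<n. (\<Sum>k<n. X i k * V j k) * cnj (\<Sum>k<n. X i k * V l k)) = (if j = l then d j else 0)"
    if "j < n" "l < n" for j l
  proof -
    have "(mat_adj M * (A * M)) $$ (l,j) = (\<Sum>r<n. \<Sum>k<n. \<Sum>i<n. cnj (X i r * V l r) * (X i k * V j k))"
      using M(1) A that
      by (simp add: V_def scalar_prod_def lessThan_atLeast0 A_def mmul_def madj_def
          sum_distrib_left sum_distrib_right mult_ac)
    also have "\<dots> = (\<Sum>r<n. \<Sum>i<n. \<Sum>k<n. cnj (X i r * V l r) * (X i k * V j k))"
      by (intro sum.cong refl sum.swap)
    also have "\<dots> = (\<Sum>i<n. \<Sum>r<n. \<Sum>k<n. cnj (X i r * V l r) * (X i k * V j k))"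
      by (rule sum.swap)
    also have "\<dots> = (\<Sum>i<n. (\<Sum>k<n. X i k * V j k) * cnj (\<Sum>k<n. X i k * V l k))"
      unfolding cnj_sum sum_product
      by (rule sum.cong [OF refl], subst sum.swap) (simp add: mult_ac)
    finally have "(\<Sum>i<n. (\<Sum>k<n. X i k * V j k) * cnj (\<Sum>k<n. X i k * V l k)) = (mat_adj M * (A * M)) $$ (l,j)"
      by simp
    also have "mat_adj M * (A * M) = D" using D(2) M(1) A by (simp add: assoc_mult_mat[of _ n n _ n _ n] mult_carrier_mat[of _ n n _ n])
    finally show ?thesis using D(1,3) that unfolding diagonal_mat_def d_def by auto
  qed
  have "M * D * mat_adj M = M * mat_adj M * A * (M * mat_adj M)"
    unfolding D(2)[symmetric] using M(1) A by (simp add: assoc_mult_mat[of _ n n _ n _ n] mult_carrier_mat[of _ n n _ n])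
  then have "A = M * D * mat_adj M" using M' A by simp
  then have "similar_mat A D"
    using A D(1) M M' by (intro similar_matI[of _ _ M "mat_adj M" n]) auto
  then have "char_poly A = char_poly D" by (rule char_poly_similar)
  also have "\<dots> = (\<Prod>a\<leftarrow>diag_mat D. [:- a, 1:])"
    using D(1,3) by (intro char_poly_upper_triangular[OF D(1)])
      (auto simp: diagonal_mat_def)
  also have "diag_mat D = map d [0..<n]" using D(1) by (auto simp: diag_mat_def d_def)
  also have "(\<Prod>a\<leftarrow>map d [0..<n]. [:- a, 1:]) = (\<Prod>j<n. [:- d j, 1:])"
    by (simp add: prod.distinct_set_conv_list[symmetric] lessThan_atLeast0 comp_def)
  finally have 4: "sv_poly n X = (\<Prod>j<n. [:- d j, 1:])" by (simp add: sv_poly_def A_def)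
  show thesis using 1 2 3 4 by (rule that)
qed

text \<open>The image of \<open>v\<close> is the combination of the \<open>U j\<close> with
  coefficients \<open>c j\<close>, and contractivity of \<open>U\<close> bounds its norm by that of
  \<open>c\<close>.\<close>

lemma svd_apply_le:
  assumes X: "is_svd n X U s V"
  shows "(vnorm n (\<lambda>i. \<Sum>k<n. X i k * v k))\<^sup>2 \<le> (\<Sum>j<n. (s j)\<^sup>2 * (cmod (\<Sum>k<n. v k * cnj (V j k)))\<^sup>2)"
proof -
  define c where "c = (\<lambda>j. complex_of_real (s j) * (\<Sum>k<n. v k * cnj (V j k)))"
  have "(\<Sum>k<n. X i k * v k) = (\<Sum>j<n. c j * U j i)" if "i < n" for i
  proof -
    have "(\<Sum>k<n. X i k * v k) = (\<Sum>k<n. \<Sum>j<n. complex_of_real (s j) * U j i * cnj (V j k) * v k)"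
      using X that by (intro sum.cong refl) (simp only: is_svd_def lessThan_iff sum_distrib_right)
    also have "\<dots> = (\<Sum>j<n. c j * U j i)"
      unfolding c_def by (subst sum.swap) (simp add: sum_distrib_left sum_distrib_right mult_ac)
    finally show ?thesis .
  qed
  then have "vnorm n (\<lambda>i. \<Sum>k<n. X i k * v k) = vnorm n (\<lambda>i. \<Sum>j<n. c j * U j i)"
    unfolding vnorm_def by simp
  also have "\<dots> \<le> vnorm n c" using X unfolding is_svd_def contractive_family_def by blast
  finally have "(vnorm n (\<lambda>i. \<Sum>k<n. X i k * v k))\<^sup>2 \<le> (vnorm n c)\<^sup>2" by (rule power_mono) simp
  also have "(vnorm n c)\<^sup>2 = (\<Sum>j<n. (s j)\<^sup>2 * (cmod (\<Sum>k<n. v k * cnj (V j k)))\<^sup>2)"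
    by (simp add: vnorm_sq c_def norm_mult power_mult_distrib)
  finally show ?thesis .
qed

lemma svd_apply_bounded:
  assumes X: "is_svd n X U s V" and C: "C \<ge> 0" "\<And>j. j < n \<Longrightarrow> s j \<le> C"
  shows "vnorm n (\<lambda>i. \<Sum>k<n. X i k * v k) \<le> C * vnorm n v"
proof -
  have cV: "contractive_family n (\<lambda>j k. cnj (V j k))" and s: "\<And>j. s j \<ge> 0"
    using X contractive_family_cnj by (auto simp: is_svd_def)
  have "(vnorm n (\<lambda>i. \<Sum>k<n. X i k * v k))\<^sup>2 \<le> (\<Sum>j<n. (s j)\<^sup>2 * (cmod (\<Sum>k<n. v k * cnj (V j k)))\<^sup>2)"
    by (rule svd_apply_le[OF X])
  also have "\<dots> \<le> (\<Sum>j<n. C\<^sup>2 * (cmod (\<Sum>k<n. v k * cnj (V j k)))\<^sup>2)"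
    by (intro sum_mono mult_right_mono power_mono) (use s C in auto)
  also have "\<dots> \<le> C\<^sup>2 * (vnorm n v)\<^sup>2"
    unfolding sum_distrib_left[symmetric] by (intro mult_left_mono contractive_family_Bessel[OF cV]) simp
  finally have "(vnorm n (\<lambda>i. \<Sum>k<n. X i k * v k))\<^sup>2 \<le> (C * vnorm n v)\<^sup>2" by (simp add: power_mult_distrib)
  then show ?thesis by (rule power2_le_imp_le) (use C in simp)
qed

text \<open>The right vectors diagonalize \<open>X^* X\<close>, the singular values are the lengths
  of their images under \<open>X\<close>, and the left vectors are the normalized images.\<close>

lemma svd_exists:
  obtains U s V where "is_svd n X U s V"
    "\<And>p. p \<noteq> \<infinity> \<Longrightarrow>
       schatten p n X = (\<Sum>j<n. s j powr real_of_ereal p) powr (1 / real_of_ereal p)"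
    "\<And>j. j < n \<Longrightarrow> vnorm n (V j) = 1"
    "\<And>j. j < n \<Longrightarrow> vnorm n (\<lambda>i. \<Sum>k<n. X i k * V j k) = s j"
proof -
  obtain V d where
    V1: "\<And>j l. j < n \<Longrightarrow> l < n \<Longrightarrow> (\<Sum>i<n. V j i * cnj (V l i)) = (if j = l then 1 else 0)" and
    V2: "\<And>i k. i < n \<Longrightarrow> k < n \<Longrightarrow> (\<Sum>j<n. V j i * cnj (V j k)) = (if i = k then 1 else 0)" and
    Y0: "\<And>j l. j < n \<Longrightarrow> l < n \<Longrightarrow>
      (\<Sum>i<n. (\<Sum>k<n. X i k * V j k) * cnj (\<Sum>k<n. X i k * V l k)) = (if j = l then d j else 0)" and
    P: "sv_poly n X = (\<Prod>j<n. [:- d j, 1:])"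
    by (rule gram_diagonalization[of n X]) (rule that)
  define y where "y = (\<lambda>j i. \<Sum>k<n. X i k * V j k)"
  define s where "s = (\<lambda>j. vnorm n (y j))"
  \<comment> \<open>Division by 0 gives 0, so \<open>U j\<close> is the zero vector when
    \<open>s j = 0\<close>.\<close>
  define U where "U = (\<lambda>j i. y j i / complex_of_real (s j))"
  have Y: "(\<Sum>i<n. y j i * cnj (y l i)) = (if j = l then d j else 0)" if "j < n" "l < n" for j l
    using Y0[OF that] by (simp add: y_def)
  have d: "d j = complex_of_real ((s j)\<^sup>2)" if "j < n" for j
    using Y[OF that that] unfolding s_def vnorm_sq_complex by simp
  have s0: "s j \<ge> 0" for j by (simp add: s_def)
  have cV: "contractive_family n V"
    by (rule contractive_familyI[where \<epsilon> = "\<lambda>_. 1"]) (use V1 in auto)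
  have UU: "(\<Sum>i<n. U j i * cnj (U l i)) = (if j = l then complex_of_real (if s j = 0 then 0 else 1) else 0)"
    if "j < n" "l < n" for j l
  proof -
    have "(\<Sum>i<n. U j i * cnj (U l i)) = (\<Sum>i<n. y j i * cnj (y l i)) / complex_of_real (s j * s l)"
      unfolding sum_divide_distrib by (intro sum.cong refl) (simp add: U_def)
    then show ?thesis using Y[OF that] d[OF that(1)] by (auto simp: power2_eq_square)
  qed
  have cU: "contractive_family n U"
    by (rule contractive_familyI[OF UU]) auto
  \<comment> \<open>For \<open>s j = 0\<close> both sides vanish, because a vector
    \<open>y j\<close> of length 0 has zero entries.\<close>
  have sU: "y j i = complex_of_real (s j) * U j i" if "i < n" for j i
  proof (cases "s j = 0")
    case True
    then have "(\<Sum>i<n. (cmod (y j i))\<^sup>2) = 0" using vnorm_sq[of n "y j"] by (simp add: s_def)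
    then have "y j i = 0" using that by (subst (asm) sum_nonneg_eq_0_iff) auto
    then show ?thesis using True by simp
  qed (simp add: U_def)
  have rep: "X i k = (\<Sum>j<n. complex_of_real (s j) * U j i * cnj (V j k))" if "i < n" "k < n" for i k
  proof -
    have "(\<Sum>j<n. complex_of_real (s j) * U j i * cnj (V j k)) = (\<Sum>j<n. (\<Sum>l<n. X i l * V j l) * cnj (V j k))"
      by (intro sum.cong refl) (simp add: sU[OF that(1), symmetric] y_def)
    also have "\<dots> = (\<Sum>l<n. X i l * (\<Sum>j<n. V j l * cnj (V j k)))"
      unfolding sum_distrib_left sum_distrib_right by (subst sum.swap) (simp add: mult_ac)
    also have "\<dots> = (\<Sum>l<n. X i l * (if l = k then 1 else 0))"
      by (intro sum.cong refl) (simp add: V2 that)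
    also have "\<dots> = X i k" using that by (simp add: if_distrib[of "\<lambda>x. _ * x"] cong: if_cong)
    finally show ?thesis by simp
  qed
  have dia: "complex_of_real (s j) = (\<Sum>i<n. \<Sum>k<n. cnj (U j i) * X i k * V j k)" if "j < n" for j
  proof -
    have "(\<Sum>i<n. \<Sum>k<n. cnj (U j i) * X i k * V j k) = (\<Sum>i<n. cnj (U j i) * y j i)"
      by (simp add: y_def sum_distrib_left mult.assoc)
    also have "\<dots> = complex_of_real (s j) * (\<Sum>i<n. U j i * cnj (U j i))"
      unfolding sum_distrib_left by (intro sum.cong refl) (simp add: sU)
    finally show ?thesis using UU[OF that that] by simp
  qed
  have "schatten p n X = (\<Sum>j<n. s j powr real_of_ereal p) powr (1 / real_of_ereal p)" if "p \<noteq> \<infinity>" for p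
  proof -
    have "schatten p n X = (\<Sum>j<n. sqrt (cmod (d j)) powr real_of_ereal p) powr (1 / real_of_ereal p)"
      using that by (simp add: schatten_def P sum_order_prod_linear)
    also have "(\<Sum>j<n. sqrt (cmod (d j)) powr real_of_ereal p) = (\<Sum>j<n. s j powr real_of_ereal p)"
      by (intro sum.cong refl) (simp add: d s0 norm_power)
    finally show ?thesis .
  qed
  moreover have "is_svd n X U s V"
    unfolding is_svd_def using cU cV s0 rep dia by blast
  moreover have "vnorm n (V j) = 1" if "j < n" for j
  proof -
    have "complex_of_real ((vnorm n (V j))\<^sup>2) = complex_of_real 1"
      unfolding vnorm_sq_complex using V1[OF that that] by simp
    then have "(vnorm n (V j))\<^sup>2 = 1" by (simp only: of_real_eq_iff)
    then show ?thesis using vnorm_nonneg[of n "V j"] by (simp add: power2_eq_1_iff)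
  qed
  ultimately show thesis
    by (intro that[of U s V]) (simp_all add: s_def y_def)
qed

section \<open>Elementary properties of the operator norm\<close>

lemma opnorm_bdd: "bdd_above (insert 0 {vnorm n (\<lambda>i. \<Sum>j<n. X i j * v j) | v. vnorm n v = 1})"
proof -
  obtain U s V where X: "is_svd n X U s V" by (rule svd_exists[of n X]) (rule that)
  \<comment> \<open>A real \<open>Sup\<close> is informative only for sets bounded above. The sum of
    the singular values is a crude bound that dominates each of them.\<close>
  define C where "C = (\<Sum>j<n. s j)"
  have s0: "s j \<ge> 0" for j using X by (simp add: is_svd_def)
  then have C: "C \<ge> 0" "\<And>j. j < n \<Longrightarrow> s j \<le> C"
    unfolding C_def by (auto intro: sum_nonneg member_le_sum)
  show ?thesis
  proof (rule bdd_aboveI)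
    fix x assume "x \<in> insert 0 {vnorm n (\<lambda>i. \<Sum>j<n. X i j * v j) | v. vnorm n v = 1}"
    then consider "x = 0" | v where "vnorm n v = 1" "x = vnorm n (\<lambda>i. \<Sum>j<n. X i j * v j)"
      by blast
    then show "x \<le> C"
    proof cases
      case 2
      then show ?thesis using svd_apply_bounded[OF X C, of v] by simp
    qed (use C in simp)
  qed
qed

lemma opnorm_nonneg [simp]: "opnorm n X \<ge> 0"
  unfolding opnorm_def by (intro cSup_upper opnorm_bdd) simp

lemma vnorm_eq_0_iff: "vnorm n v = 0 \<longleftrightarrow> (\<forall>i<n. v i = 0)"
  by (auto simp: vnorm_def sum_nonneg_eq_0_iff)

lemma vnorm_apply_le_opnorm: "vnorm n (\<lambda>i. \<Sum>j<n. X i j * v j) \<le> opnorm n X * vnorm n v"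
proof (cases "vnorm n v = 0")
  case True
  then show ?thesis by (simp add: vnorm_eq_0_iff) (simp add: vnorm_def)
next
  case False
  define w where "w = (\<lambda>j. complex_of_real (1 / vnorm n v) * v j)"
  have "vnorm n w = 1" unfolding w_def vnorm_scale using False by (simp add: norm_divide)
  then have "vnorm n (\<lambda>i. \<Sum>j<n. X i j * w j) \<le> opnorm n X"
    unfolding opnorm_def by (intro cSup_upper opnorm_bdd) auto
  moreover have "(\<lambda>i. \<Sum>j<n. X i j * w j) = (\<lambda>i. complex_of_real (1 / vnorm n v) * (\<Sum>j<n. X i j * v j))"
    by (simp add: w_def sum_distrib_left mult_ac)
  ultimately have "1 / vnorm n v * vnorm n (\<lambda>i. \<Sum>j<n. X i j * v j) \<le> opnorm n X"
    by (simp add: vnorm_scale norm_divide del: of_real_divide)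
  moreover have "vnorm n v > 0" using False vnorm_nonneg[of n v] by linarith
  ultimately show ?thesis by (simp add: field_simps)
qed

lemma opnorm_least:
  assumes "C \<ge> 0" "\<And>v. vnorm n v = 1 \<Longrightarrow> vnorm n (\<lambda>i. \<Sum>j<n. X i j * v j) \<le> C"
  shows "opnorm n X \<le> C"
  unfolding opnorm_def by (rule cSup_least) (use assms in auto)

section \<open>Schatten norms through weights and duality\<close>

lemma schatten_nonneg: "schatten p n X \<ge> 0"
  by (simp add: schatten_def opnorm_nonneg)

text \<open>The case \<open>p = \<infinity>\<close> uses \<open>x powr 0 = 1\<close> for positive \<open>x\<close>, hence uniform weights.\<close>
lemma schatten_weights:
  assumes p: "1 \<le> p" and L: "0 \<le> L" and le: "schatten p n X \<le> L"
  obtains U s V E where "is_svd n X U s V" "\<And>k. 0 \<le> E k" "(\<Sum>k<n. E k) \<le> 1"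
    "\<And>k. k < n \<Longrightarrow> s k \<le> L * E k powr ereal_inv p"
proof -
  obtain U s V where X: "is_svd n X U s V"
    and sch: "\<And>p. p \<noteq> \<infinity> \<Longrightarrow> schatten p n X = (\<Sum>j<n. s j powr real_of_ereal p) powr (1 / real_of_ereal p)"
    and sV: "\<And>j. j < n \<Longrightarrow> vnorm n (V j) = 1"
      "\<And>j. j < n \<Longrightarrow> vnorm n (\<lambda>i. \<Sum>k<n. X i k * V j k) = s j"
    by (rule svd_exists[of n X]) (rule that)
  have s0: "s j \<ge> 0" for j using X by (simp add: is_svd_def)
  show thesis
  proof (cases "p = \<infinity>")
    case True
    show thesis
    proof (rule that[OF X])
      show "0 \<le> 1 / real (Suc n)" for k :: nat by simp
      show "(\<Sum>k<n. 1 / real (Suc n)) \<le> 1" by (simp add: field_simps)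
      show "s k \<le> L * (1 / real (Suc n)) powr ereal_inv p" if "k < n" for k
        using vnorm_apply_le_opnorm[of n X "V k"] sV[OF that] le True
        by (simp add: schatten_def ereal_inv_def)
    qed
  next
    case False
    define r where "r = real_of_ereal p"
    have r: "r \<ge> 1" using p False unfolding r_def by (cases p) (auto simp: one_ereal_def)
    define S where "S = (\<Sum>j<n. s j powr r)"
    have S0: "S \<ge> 0" unfolding S_def by (intro sum_nonneg) simp
    have SL: "S powr (1 / r) \<le> L" using le sch[OF False] by (simp add: S_def r_def)
    show thesis
    proof (rule that[OF X])
      \<comment> \<open>If \<open>S = 0\<close>, division by 0 makes all weights 0; otherwise they
        add up to 1.\<close>
      show "0 \<le> s k powr r / S" for k using S0 by simp
      show "(\<Sum>k<n. s k powr r / S) \<le> 1"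
        unfolding sum_divide_distrib[symmetric] S_def[symmetric] by simp
      show "s k \<le> L * (s k powr r / S) powr ereal_inv p" if "k < n" for k
      proof (cases "s k = 0")
        case False
        have "s k powr r \<le> S"
          unfolding S_def using that by (intro member_le_sum) auto
        moreover have "s k powr r > 0" using False by simp
        ultimately have Spos: "S > 0" by linarith
        have "s k = S powr (1 / r) * (s k powr r / S) powr (1 / r)"
          using Spos s0[of k] r by (simp add: powr_divide powr_powr)
        also have "\<dots> \<le> L * (s k powr r / S) powr (1 / r)"
          by (rule mult_right_mono[OF SL]) simp
        finally show ?thesis using \<open>p \<noteq> \<infinity>\<close> by (simp add: ereal_inv_def r_def)
      qed (use L in simp)
    qed
  qed
qed

text \<open>Converse of Hoelder's inequality. For nonnegative \<open>Y\<close> with sum at most 1,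
  the numbers \<open>Y k powr (1 - ereal_inv q)\<close> lie in the unit ball of the space dual to
  l_q, and an extremal choice of \<open>Y\<close> recovers the norm of the singular values.\<close>

lemma schatten_le_dual:
  assumes q: "1 \<le> q" and C: "0 \<le> C"
    and le: "\<And>U s V Y. is_svd n X U s V \<Longrightarrow> (\<And>k. 0 \<le> Y k) \<Longrightarrow> (\<Sum>k<n. Y k) \<le> 1 \<Longrightarrow>
      (\<Sum>k<n. s k * Y k powr (1 - ereal_inv q)) \<le> C"
  shows "schatten q n X \<le> C"
proof -
  obtain U s V where X: "is_svd n X U s V"
    and sch: "\<And>p. p \<noteq> \<infinity> \<Longrightarrow> schatten p n X = (\<Sum>j<n. s j powr real_of_ereal p) powr (1 / real_of_ereal p)"
    by (rule svd_exists[of n X]) (rule that)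
  have s0: "s j \<ge> 0" for j using X by (simp add: is_svd_def)
  show ?thesis
  proof (cases "q = \<infinity>")
    case True
    have "s j \<le> C" if "j < n" for j
    proof -
      \<comment> \<open>A point mass at \<open>j\<close> isolates \<open>s j\<close>, the exponent
        being 1 for infinite \<open>q\<close>.\<close>
      have "(\<Sum>k<n. s k * (if k = j then 1 else 0) powr (1 - ereal_inv q)) \<le> C"
        using that by (intro le[OF X]) auto
      also have "(\<Sum>k<n. s k * (if k = j then 1 else 0) powr (1 - ereal_inv q)) = (\<Sum>k<n. if k = j then s k else 0)"
        by (intro sum.cong) (auto simp: True ereal_inv_def)
      finally show ?thesis using that by simp
    qed
    then have "opnorm n X \<le> C"
    proof (intro opnorm_least C)
      show "vnorm n (\<lambda>i. \<Sum>j<n. X i j * v j) \<le> C" if "vnorm n v = 1" for v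
        using svd_apply_bounded[OF X C \<open>\<And>j. j < n \<Longrightarrow> s j \<le> C\<close>, of v] that by simp
    qed
    then show ?thesis using True by (simp add: schatten_def)
  next
    case False
    define r where "r = real_of_ereal q"
    have r: "r \<ge> 1" using q False unfolding r_def by (cases q) (auto simp: one_ereal_def)
    define S where "S = (\<Sum>j<n. s j powr r)"
    have S0: "S \<ge> 0" unfolding S_def by (intro sum_nonneg) simp
    show ?thesis
    proof (cases "S = 0")
      case True
      then show ?thesis using sch[OF False] C by (simp add: S_def r_def)
    next
      case Sn: False
      then have Spos: "S > 0" using S0 by simp
      \<comment> \<open>The extremal weights are proportional to \<open>s k powr r\<close>; the
        pairing with them equals \<open>S powr (1 / r)\<close>, which is the Schatten norm.\<close>
      have "(\<Sum>k<n. s k * (s k powr r / S) powr (1 - ereal_inv q)) \<le> C"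
        by (rule le[OF X]) (use Spos in \<open>auto simp: S_def simp flip: sum_divide_distrib\<close>)
      moreover have "s k * (s k powr r / S) powr (1 - ereal_inv q) = s k powr r * S powr (1 / r - 1)" for k
      proof (cases "s k = 0")
        case nz: False
        have "(s k powr r / S) powr (1 - 1 / r) = s k powr (r * (1 - 1 / r)) / S powr (1 - 1 / r)"
          using Spos s0[of k] by (simp add: powr_divide powr_powr)
        also have "r * (1 - 1 / r) = r - 1" using r by (simp add: field_simps)
        also have "s k powr (r - 1) / S powr (1 - 1 / r) = s k powr (r - 1) * S powr (1 / r - 1)"
          by (simp add: powr_minus_divide[symmetric] divide_inverse powr_minus[symmetric])
        finally have "s k * (s k powr r / S) powr (1 - 1 / r) = (s k powr 1 * s k powr (r - 1)) * S powr (1 / r - 1)"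
          using s0[of k] by simp
        also have "s k powr 1 * s k powr (r - 1) = s k powr r" by (simp only: powr_add [symmetric]) simp
        finally show ?thesis using False by (simp add: ereal_inv_def r_def)
      qed simp
      ultimately have "S * S powr (1 / r - 1) \<le> C"
        by (simp add: S_def sum_distrib_right)
      moreover have "S * S powr (1 / r - 1) = S powr (1 / r)"
        using Spos powr_add[of S 1 "1 / r - 1"] by simp
      ultimately show ?thesis using sch[OF False] by (simp add: S_def r_def)
    qed
  qed
qed

subsection \<open>A trilinear Young inequality\<close>

text \<open>Weighted arithmetic-geometric mean inequality for \<open>x y\<close>, \<open>e y\<close>, \<open>e x\<close> with weights
  \<open>1 - \<alpha>\<close>, \<open>1 - \<beta>\<close>, \<open>1 - \<gamma>\<close>.\<close>
lemma powr_triple_le: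
  fixes e x y \<alpha> \<beta> \<gamma> :: real
  assumes nn: "0 \<le> e" "0 \<le> x" "0 \<le> y" and le: "\<alpha> \<le> 1" "\<beta> \<le> 1" "\<gamma> \<le> 1" and sum: "\<alpha> + \<beta> + \<gamma> = 2"
  shows "e powr \<alpha> * x powr \<beta> * y powr \<gamma> \<le> (1 - \<alpha>) * (x * y) + (1 - \<beta>) * (e * y) + (1 - \<gamma>) * (e * x)"
\<comment> \<open>Since \<open>0 powr 0 = 0\<close>, the left side vanishes even if the vanishing
  base has exponent 0.\<close>
proof (cases "e = 0 \<or> x = 0 \<or> y = 0")
  case True
  then have "e powr \<alpha> * x powr \<beta> * y powr \<gamma> = 0" by auto
  moreover have "0 \<le> (1 - \<alpha>) * (x * y)" "0 \<le> (1 - \<beta>) * (e * y)" "0 \<le> (1 - \<gamma>) * (e * x)"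
    using nn le by simp_all
  ultimately show ?thesis by linarith
next
  case False
  then have pos: "e > 0" "x > 0" "y > 0" using nn by auto
  define l where "l = \<alpha> * ln e + \<beta> * ln x + \<gamma> * ln y"
  have G: "e powr \<alpha> * x powr \<beta> * y powr \<gamma> = exp l"
    using pos by (simp add: powr_def l_def exp_add)
  \<comment> \<open>By convexity, the tangent line of \<open>exp\<close> at \<open>l\<close> lies
    below \<open>exp (ln w) = w\<close>.\<close>
  have tangent: "exp l * (1 + (ln w - l)) \<le> w" if "w > 0" for w
  proof -
    have "exp l * (1 + (ln w - l)) \<le> exp l * exp (ln w - l)"
      by (intro mult_left_mono exp_ge_add_one_self) simp
    also have "\<dots> = w" using that by (simp add: exp_diff)
    finally show ?thesis .
  qed
  have \<gamma>: "\<gamma> = 2 - \<alpha> - \<beta>" using sum by simp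
  \<comment> \<open>The three weights add up to 1 and the weighted mean of the three logarithms is
    \<open>l\<close>, so the first-order terms cancel.\<close>
  have "exp l = (1 - \<alpha>) * (exp l * (1 + (ln (x * y) - l))) + (1 - \<beta>) * (exp l * (1 + (ln (e * y) - l)))
      + (1 - \<gamma>) * (exp l * (1 + (ln (e * x) - l)))"
    using pos unfolding l_def \<gamma> by (simp add: ln_mult algebra_simps)
  also have "\<dots> \<le> (1 - \<alpha>) * (x * y) + (1 - \<beta>) * (e * y) + (1 - \<gamma>) * (e * x)"
    by (intro add_mono mult_left_mono tangent) (use pos le in auto)
  finally show ?thesis unfolding G .
qed

lemma sum_weighted_le:
  fixes f :: "nat \<Rightarrow> nat \<Rightarrow> real"
  assumes f: "\<And>j k. j < m \<Longrightarrow> k < n \<Longrightarrow> f j k \<le> M" and M: "0 \<le> M"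
    and X: "\<And>j. 0 \<le> X j" "(\<Sum>j<m. X j) \<le> 1" and Y: "\<And>k. 0 \<le> Y k" "(\<Sum>k<n. Y k) \<le> 1"
  shows "(\<Sum>j<m. \<Sum>k<n. f j k * (X j * Y k)) \<le> M"
proof -
  have "(\<Sum>j<m. \<Sum>k<n. f j k * (X j * Y k)) \<le> (\<Sum>j<m. \<Sum>k<n. M * (X j * Y k))"
    by (intro sum_mono mult_right_mono f) (auto simp: X Y)
  also have "\<dots> = M * ((\<Sum>j<m. X j) * (\<Sum>k<n. Y k))"
    unfolding sum_product by (simp only: sum_distrib_left)
  also have "\<dots> \<le> M * 1"
    by (intro mult_left_mono mult_le_one X Y sum_nonneg M)
  finally show ?thesis by simp
qed

text \<open>After \<open>powr_triple_le\<close> each summand carries only two of the three weights,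
  so \<open>K\<close> can be summed over the free index and is bounded by \<open>M\<close>. The
  coefficients add up to \<open>3 - (\<alpha> + \<beta> + \<gamma>) = 1\<close>.\<close>

lemma trilinear_Young:
  fixes K :: "nat \<Rightarrow> nat \<Rightarrow> nat \<Rightarrow> real"
  assumes K0: "\<And>l j k. 0 \<le> K l j k" and M: "0 \<le> M"
    and K1: "\<And>j k. j < m \<Longrightarrow> k < n \<Longrightarrow> (\<Sum>l<N. K l j k) \<le> M"
    and K2: "\<And>l k. l < N \<Longrightarrow> k < n \<Longrightarrow> (\<Sum>j<m. K l j k) \<le> M"
    and K3: "\<And>l j. l < N \<Longrightarrow> j < m \<Longrightarrow> (\<Sum>k<n. K l j k) \<le> M"
    and E: "\<And>l. 0 \<le> E l" "(\<Sum>l<N. E l) \<le> 1"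
    and X: "\<And>j. 0 \<le> X j" "(\<Sum>j<m. X j) \<le> 1" and Y: "\<And>k. 0 \<le> Y k" "(\<Sum>k<n. Y k) \<le> 1"
    and exps: "\<alpha> \<le> 1" "\<beta> \<le> 1" "\<gamma> \<le> 1" "\<alpha> + \<beta> + \<gamma> = 2"
  shows "(\<Sum>l<N. \<Sum>j<m. \<Sum>k<n. K l j k * (E l powr \<alpha> * X j powr \<beta> * Y k powr \<gamma>)) \<le> M"
proof -
  have "(\<Sum>l<N. \<Sum>j<m. \<Sum>k<n. K l j k * (E l powr \<alpha> * X j powr \<beta> * Y k powr \<gamma>))
    \<le> (\<Sum>l<N. \<Sum>j<m. \<Sum>k<n. K l j k *
        ((1 - \<alpha>) * (X j * Y k) + (1 - \<beta>) * (E l * Y k) + (1 - \<gamma>) * (E l * X j)))"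
    by (intro sum_mono mult_left_mono K0 powr_triple_le E X Y exps)
  also have "\<dots> = (1 - \<alpha>) * (\<Sum>l<N. \<Sum>j<m. \<Sum>k<n. K l j k * (X j * Y k))
      + (1 - \<beta>) * (\<Sum>l<N. \<Sum>j<m. \<Sum>k<n. K l j k * (E l * Y k))
      + (1 - \<gamma>) * (\<Sum>l<N. \<Sum>j<m. \<Sum>k<n. K l j k * (E l * X j))"
    by (simp add: ring_distribs sum.distrib sum_distrib_left mult.left_commute del: left_diff_distrib)
  also have "(\<Sum>l<N. \<Sum>j<m. \<Sum>k<n. K l j k * (X j * Y k)) = (\<Sum>j<m. \<Sum>k<n. (\<Sum>l<N. K l j k) * (X j * Y k))"
    unfolding sum_distrib_right by (subst sum.swap) (intro sum.cong refl sum.swap)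
  also have "(\<Sum>l<N. \<Sum>j<m. \<Sum>k<n. K l j k * (E l * Y k)) = (\<Sum>l<N. \<Sum>k<n. (\<Sum>j<m. K l j k) * (E l * Y k))"
    unfolding sum_distrib_right by (intro sum.cong refl sum.swap)
  also have "(\<Sum>l<N. \<Sum>j<m. \<Sum>k<n. K l j k * (E l * X j)) = (\<Sum>l<N. \<Sum>j<m. (\<Sum>k<n. K l j k) * (E l * X j))"
    unfolding sum_distrib_right ..
  also have "(1 - \<alpha>) * (\<Sum>j<m. \<Sum>k<n. (\<Sum>l<N. K l j k) * (X j * Y k))
      + (1 - \<beta>) * (\<Sum>l<N. \<Sum>k<n. (\<Sum>j<m. K l j k) * (E l * Y k))
      + (1 - \<gamma>) * (\<Sum>l<N. \<Sum>j<m. (\<Sum>k<n. K l j k) * (E l * X j))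
    \<le> (1 - \<alpha>) * M + (1 - \<beta>) * M + (1 - \<gamma>) * M"
    using exps by (intro add_mono mult_left_mono sum_weighted_le M E X Y) (auto simp: K1 K2 K3)
  also have "\<dots> = (3 - (\<alpha> + \<beta> + \<gamma>)) * M" by (simp add: algebra_simps)
  finally show ?thesis using exps(4) by simp
qed

subsection \<open>The trilinear form and the completely positive map\<close>

text \<open>No argument is conjugated, so that \<open>tri\<close> is linear in each slot and
  \<open>contractive_family_functional\<close> applies to any of them; conjugates are supplied where
  the form is used.\<close>

definition bil :: "nat \<Rightarrow> cmatrix \<Rightarrow> (nat \<Rightarrow> complex) \<Rightarrow> (nat \<Rightarrow> complex) \<Rightarrow> complex" where
  "bil n R u y = (\<Sum>i<n. y i * (\<Sum>k<n. R i k * u k))"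

definition tri :: "nat \<Rightarrow> nat \<Rightarrow> (nat \<Rightarrow> cmatrix) \<Rightarrow>
    (nat \<Rightarrow> complex) \<Rightarrow> (nat \<Rightarrow> complex) \<Rightarrow> (nat \<Rightarrow> complex) \<Rightarrow> complex" where
  "tri n N T v u y = (\<Sum>b<N. v b * bil n (T b) u y)"

lemma bil_le: "cmod (bil n R u y) \<le> opnorm n R * vnorm n u * vnorm n y"
proof -
  have "cmod (bil n R u y) \<le> vnorm n y * vnorm n (\<lambda>i. \<Sum>k<n. R i k * u k)"
    unfolding bil_def by (rule vnorm_Cauchy_Schwarz)
  also have "\<dots> \<le> vnorm n y * (opnorm n R * vnorm n u)"
    by (intro mult_left_mono vnorm_apply_le_opnorm) simp
  finally show ?thesis by (simp add: mult_ac)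
qed

lemma bil_sum:
  assumes "\<And>i k. i < n \<Longrightarrow> k < n \<Longrightarrow> R i k = (\<Sum>b<N. v b * T b i k)"
  shows "bil n R u y = (\<Sum>b<N. v b * bil n (T b) u y)"
proof -
  have "bil n R u y = (\<Sum>i<n. \<Sum>k<n. \<Sum>b<N. v b * (y i * (T b i k * u k)))"
    unfolding bil_def sum_distrib_left
    by (intro sum.cong refl) (simp add: assms sum_distrib_left sum_distrib_right mult_ac)
  also have "\<dots> = (\<Sum>i<n. \<Sum>b<N. \<Sum>k<n. v b * (y i * (T b i k * u k)))"
    by (intro sum.cong refl sum.swap)
  also have "\<dots> = (\<Sum>b<N. \<Sum>i<n. \<Sum>k<n. v b * (y i * (T b i k * u k)))"
    by (rule sum.swap)
  also have "\<dots> = (\<Sum>b<N. v b * bil n (T b) u y)"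
    unfolding bil_def sum_distrib_left ..
  finally show ?thesis .
qed

lemma tri_eq_bil: "tri n N T v u y = bil n (\<lambda>i k. \<Sum>b<N. v b * T b i k) u y"
  unfolding tri_def by (rule bil_sum [symmetric]) simp

text \<open>This and the next two identities display the form as a linear functional of
  \<open>v\<close>, of \<open>y\<close> and of \<open>u\<close>, respectively.\<close>

lemma tri_eq_left: "tri n N T v u y = (\<Sum>b<N. bil n (T b) u y * v b)"
  by (simp add: tri_def mult.commute)

lemma tri_eq_right: "tri n N T v u y = (\<Sum>i<n. (\<Sum>k<n. (\<Sum>b<N. v b * T b i k) * u k) * y i)"
  by (simp add: tri_eq_bil bil_def mult.commute)

lemma tri_eq_middle: "tri n N T v u y = (\<Sum>k<n. (\<Sum>i<n. y i * (\<Sum>b<N. v b * T b i k)) * u k)"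
  unfolding tri_eq_bil bil_def sum_distrib_left sum_distrib_right
  by (subst sum.swap) (simp add: mult_ac)

text \<open>The hypothesis is what a bound \<open>c\<close> on \<open>min_norm\<close> gives for the
  first \<open>N\<close> coordinates. Rescaling \<open>v\<close> to a unit vector reduces the claim
  to \<open>bil_le\<close>.\<close>

lemma tri_le:
  assumes c: "\<And>v. vnorm N v = 1 \<Longrightarrow> opnorm n (\<lambda>i k. \<Sum>b<N. v b * T b i k) \<le> c"
  shows "cmod (tri n N T v u y) \<le> c * vnorm N v * vnorm n u * vnorm n y"
proof (cases "vnorm N v = 0")
  case True
  then have "tri n N T v u y = 0" by (simp add: tri_def vnorm_eq_0_iff)
  then show ?thesis using True by simp
next
  case False
  define w where "w = (\<lambda>b. complex_of_real (1 / vnorm N v) * v b)"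
  have w: "vnorm N w = 1" unfolding w_def vnorm_scale using False by (simp add: norm_divide)
  have "cmod (tri n N T w u y) \<le> c * vnorm n u * vnorm n y"
    unfolding tri_eq_bil by (rule order_trans [OF bil_le]) (intro mult_right_mono c w vnorm_nonneg)
  moreover have "tri n N T w u y = complex_of_real (1 / vnorm N v) * tri n N T v u y"
    unfolding tri_def w_def by (simp add: sum_distrib_left mult.assoc)
  ultimately have "1 / vnorm N v * cmod (tri n N T v u y) \<le> c * vnorm n u * vnorm n y"
    by (simp add: norm_mult norm_divide del: of_real_divide)
  moreover have "vnorm N v > 0" using False vnorm_nonneg[of N v] by linarith
  ultimately show ?thesis by (simp add: field_simps)
qed

context
  fixes n N T c
  assumes c0: "0 \<le> c"
    and tri_bound: "\<And>v u y. cmod (tri n N T v u y) \<le> c * vnorm N v * vnorm n u * vnorm n y"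
begin

text \<open>Fixing the other two arguments in the unit ball leaves a linear functional of norm at
  most \<open>c\<close>, to which \<open>contractive_family_functional\<close> applies. The other
  two slots are treated alike.\<close>

lemma tri_sum_left:
  assumes G: "contractive_family N G" and "vnorm n u \<le> 1" "vnorm n y \<le> 1"
  shows "(\<Sum>l<N. (cmod (tri n N T (G l) u y))\<^sup>2) \<le> c\<^sup>2"
  unfolding tri_eq_left
proof (rule contractive_family_functional[OF G c0])
  fix v
  have "c * vnorm N v * vnorm n u * vnorm n y \<le> c * vnorm N v * 1 * 1"
    by (intro mult_mono mult_nonneg_nonneg) (use assms c0 in auto)
  with tri_bound[of v u y] show "cmod (\<Sum>b<N. bil n (T b) u y * v b) \<le> c * vnorm N v"
    unfolding tri_eq_left by simp
qed

lemma tri_sum_middle: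
  assumes G: "contractive_family n G" and "vnorm N v \<le> 1" "vnorm n y \<le> 1"
  shows "(\<Sum>j<n. (cmod (tri n N T v (G j) y))\<^sup>2) \<le> c\<^sup>2"
  unfolding tri_eq_middle
proof (rule contractive_family_functional[OF G c0])
  fix u
  have "c * vnorm N v * vnorm n u * vnorm n y \<le> c * 1 * vnorm n u * 1"
    by (intro mult_mono mult_nonneg_nonneg) (use assms c0 in auto)
  with tri_bound[of v u y] 
  show "cmod (\<Sum>k<n. (\<Sum>i<n. y i * (\<Sum>b<N. v b * T b i k)) * u k) \<le> c * vnorm n u"
    unfolding tri_eq_middle by simp
qed

lemma tri_sum_right:
  assumes G: "contractive_family n G" and "vnorm N v \<le> 1" "vnorm n u \<le> 1"
  shows "(\<Sum>k<n. (cmod (tri n N T v u (G k)))\<^sup>2) \<le> c\<^sup>2"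
  unfolding tri_eq_right
proof (rule contractive_family_functional[OF G c0])
  fix y
  have "c * vnorm N v * vnorm n u * vnorm n y \<le> c * 1 * 1 * vnorm n y"
    by (intro mult_mono mult_nonneg_nonneg) (use assms c0 in auto)
  with tri_bound[of v u y] 
  show "cmod (\<Sum>i<n. (\<Sum>k<n. (\<Sum>b<N. v b * T b i k) * u k) * y i) \<le> c * vnorm n y"
    unfolding tri_eq_right by simp
qed

end

text \<open>Inserting the expansion of \<open>x\<close> splits each \<open>S h x (S h)^*\<close>
  into rank-one terms, and the double sum over \<open>i\<close> and \<open>k\<close> factors on each
  of them. With singular vectors of the image as \<open>P\<close> and \<open>W\<close>, the left
  side is a singular value of \<open>rho n m S x\<close>.\<close>

lemma rho_coefficient:
  assumes x: "\<And>p r. p < n \<Longrightarrow> r < n \<Longrightarrow> x p r = (\<Sum>j<n. complex_of_real (\<xi> j) * U j p * cnj (V j r))"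
  shows "(\<Sum>i<n. \<Sum>k<n. cnj (P i) * rho n m S x i k * W k)
    = (\<Sum>h<m. \<Sum>j<n. complex_of_real (\<xi> j) * bil n (S h) (U j) (\<lambda>i. cnj (P i)) * cnj (bil n (S h) (V j) (\<lambda>i. cnj (W i))))"
proof -
  have "mmul n (mmul n (S h) x) (madj (S h)) i k
    = (\<Sum>j<n. complex_of_real (\<xi> j) * (\<Sum>p<n. S h i p * U j p) * cnj (\<Sum>r<n. S h k r * V j r))" for h i k
  proof -
    have "mmul n (mmul n (S h) x) (madj (S h)) i k
      = (\<Sum>r<n. \<Sum>p<n. \<Sum>j<n. complex_of_real (\<xi> j) * ((S h i p * U j p) * cnj (S h k r * V j r)))"
      unfolding mmul_def madj_def sum_distrib_right
      by (intro sum.cong refl) (simp add: x sum_distrib_left sum_distrib_right mult_ac)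
    also have "\<dots> = (\<Sum>r<n. \<Sum>j<n. \<Sum>p<n. complex_of_real (\<xi> j) * ((S h i p * U j p) * cnj (S h k r * V j r)))"
      by (intro sum.cong refl sum.swap)
    also have "\<dots> = (\<Sum>j<n. \<Sum>r<n. \<Sum>p<n. complex_of_real (\<xi> j) * ((S h i p * U j p) * cnj (S h k r * V j r)))"
      by (rule sum.swap)
    also have "\<dots> = (\<Sum>j<n. complex_of_real (\<xi> j) * ((\<Sum>p<n. S h i p * U j p) * cnj (\<Sum>r<n. S h k r * V j r)))"
      unfolding cnj_sum sum_product by (subst sum.swap) (simp only: sum_distrib_left)
    finally show ?thesis by (simp only: mult.assoc)
  qed
  then have "(\<Sum>i<n. \<Sum>k<n. cnj (P i) * rho n m S x i k * W k)
    = (\<Sum>i<n. \<Sum>k<n. \<Sum>h<m. \<Sum>j<n. complex_of_real (\<xi> j) *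
        ((cnj (P i) * (\<Sum>p<n. S h i p * U j p)) * cnj (cnj (W k) * (\<Sum>r<n. S h k r * V j r))))"
    unfolding rho_def sum_distrib_left sum_distrib_right
    by (intro sum.cong refl) (simp add: sum_distrib_left sum_distrib_right mult_ac)
  also have "\<dots> = (\<Sum>i<n. \<Sum>h<m. \<Sum>j<n. \<Sum>k<n. complex_of_real (\<xi> j) *
        ((cnj (P i) * (\<Sum>p<n. S h i p * U j p)) * cnj (cnj (W k) * (\<Sum>r<n. S h k r * V j r))))"
    by (rule sum.cong[OF refl], subst sum.swap, rule sum.cong[OF refl], rule sum.swap)
  also have "\<dots> = (\<Sum>h<m. \<Sum>j<n. \<Sum>i<n. \<Sum>k<n. complex_of_real (\<xi> j) *
        ((cnj (P i) * (\<Sum>p<n. S h i p * U j p)) * cnj (cnj (W k) * (\<Sum>r<n. S h k r * V j r))))"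
    by (subst sum.swap, rule sum.cong[OF refl], rule sum.swap)
  also have "\<dots> = (\<Sum>h<m. \<Sum>j<n. complex_of_real (\<xi> j) *
      (bil n (S h) (U j) (\<lambda>i. cnj (P i)) * cnj (bil n (S h) (V j) (\<lambda>i. cnj (W i)))))"
    unfolding bil_def cnj_sum sum_product by (simp only: sum_distrib_left)
  finally show ?thesis by (simp only: mult.assoc)
qed

lemma mult_le_mean_squares: "a * b \<le> (a\<^sup>2 + b\<^sup>2) / (2::real)"
  using sum_squares_bound[of a b] by simp

text \<open>The coefficient formula and the triangle inequality bound \<open>s k\<close> by products
  of two \<open>bil\<close> values. Passing to the mean of their squares separates the pair
  \<open>U\<close>, \<open>P\<close> from the pair \<open>V\<close>, \<open>W\<close>, and each
  remaining sum over \<open>h\<close> is controlled by the singular values of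
  \<open>a\<close>.\<close>

lemma singular_value_rho_le:
  assumes a: "is_svd N a F d G" and x: "is_svd n x U \<xi> V" and Z: "is_svd n (rho n m S x) P s W"
    and m: "m \<le> N" and k: "k < n"
    and S: "\<And>h i j. h < m \<Longrightarrow> i < n \<Longrightarrow> j < n \<Longrightarrow> S h i j = (\<Sum>b<N. a h b * T b i j)"
  shows "s k \<le> (\<Sum>l<N. \<Sum>j<n. (d l)\<^sup>2 * \<xi> j *
    (((cmod (tri n N T (\<lambda>b. cnj (G l b)) (U j) (\<lambda>i. cnj (P k i))))\<^sup>2 +
      (cmod (tri n N T (\<lambda>b. cnj (G l b)) (V j) (\<lambda>i. cnj (W k i))))\<^sup>2) / 2))"
proof -
  define y z where "y = (\<lambda>i. cnj (P k i))" and "z = (\<lambda>i. cnj (W k i))"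
  have \<xi>0: "\<xi> j \<ge> 0" for j using x by (simp add: is_svd_def)
  have s0: "s k \<ge> 0" using Z by (simp add: is_svd_def)
  have main: "(\<Sum>h<m. (cmod (bil n (S h) u w))\<^sup>2) \<le> (\<Sum>l<N. (d l)\<^sup>2 * (cmod (tri n N T (\<lambda>b. cnj (G l b)) u w))\<^sup>2)"
    for u w
  proof -
    define \<tau> where "\<tau> = (\<lambda>b. bil n (T b) u w)"
    have "(\<Sum>h<m. (cmod (bil n (S h) u w))\<^sup>2) = (\<Sum>h<m. (cmod (\<Sum>b<N. a h b * \<tau> b))\<^sup>2)"
      unfolding \<tau>_def using S by (intro sum.cong refl) (simp add: bil_sum[where T = T and N = N and v = "a _"])
    \<comment> \<open>Adding the rows from \<open>m\<close> to \<open>N\<close> only increases the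
      sum, which becomes the squared norm of the \<open>N\<close>-section of \<open>a\<close>
      applied to \<open>\<tau>\<close>.\<close>
    also have "\<dots> \<le> (\<Sum>h<N. (cmod (\<Sum>b<N. a h b * \<tau> b))\<^sup>2)"
      using m by (intro sum_mono2) auto
    also have "\<dots> \<le> (\<Sum>l<N. (d l)\<^sup>2 * (cmod (\<Sum>b<N. \<tau> b * cnj (G l b)))\<^sup>2)"
      using svd_apply_le[OF a, of \<tau>] by (simp add: vnorm_sq)
    finally show ?thesis by (simp add: tri_eq_left \<tau>_def)
  qed
  have "complex_of_real (s k) = (\<Sum>h<m. \<Sum>j<n. complex_of_real (\<xi> j) * bil n (S h) (U j) y * cnj (bil n (S h) (V j) z))"
  proof -
    have "complex_of_real (s k) = (\<Sum>i<n. \<Sum>l<n. cnj (P k i) * rho n m S x i l * W k l)"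
      using Z k unfolding is_svd_def by blast
    also have "\<dots> = (\<Sum>h<m. \<Sum>j<n. complex_of_real (\<xi> j) * bil n (S h) (U j) y * cnj (bil n (S h) (V j) z))"
      unfolding y_def z_def by (rule rho_coefficient) (use x in \<open>auto simp only: is_svd_def\<close>)
    finally show ?thesis .
  qed
  then have "s k = cmod (\<Sum>h<m. \<Sum>j<n. complex_of_real (\<xi> j) * bil n (S h) (U j) y * cnj (bil n (S h) (V j) z))"
    using s0 by (simp only: norm_of_real abs_of_nonneg flip: \<open>complex_of_real (s k) = _\<close>)
  also have "\<dots> \<le> (\<Sum>h<m. \<Sum>j<n. \<xi> j * (((cmod (bil n (S h) (U j) y))\<^sup>2 + (cmod (bil n (S h) (V j) z))\<^sup>2) / 2))"
  proof (intro sum_norm_le)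
    fix h j
    have "cmod (complex_of_real (\<xi> j) * bil n (S h) (U j) y * cnj (bil n (S h) (V j) z))
      = \<xi> j * (cmod (bil n (S h) (U j) y) * cmod (bil n (S h) (V j) z))"
      using \<xi>0 by (simp add: norm_mult)
    also have "\<dots> \<le> \<xi> j * (((cmod (bil n (S h) (U j) y))\<^sup>2 + (cmod (bil n (S h) (V j) z))\<^sup>2) / 2)"
      by (intro mult_left_mono mult_le_mean_squares \<xi>0)
    finally show "cmod (complex_of_real (\<xi> j) * bil n (S h) (U j) y * cnj (bil n (S h) (V j) z))
      \<le> \<xi> j * (((cmod (bil n (S h) (U j) y))\<^sup>2 + (cmod (bil n (S h) (V j) z))\<^sup>2) / 2)" .
  qed
  also have "\<dots> = (\<Sum>j<n. \<xi> j * (((\<Sum>h<m. (cmod (bil n (S h) (U j) y))\<^sup>2) + (\<Sum>h<m. (cmod (bil n (S h) (V j) z))\<^sup>2)) / 2))"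
    by (subst sum.swap) (simp only: sum_distrib_left sum.distrib sum_divide_distrib add_divide_distrib ring_distribs)
  also have "\<dots> \<le> (\<Sum>j<n. \<xi> j * (((\<Sum>l<N. (d l)\<^sup>2 * (cmod (tri n N T (\<lambda>b. cnj (G l b)) (U j) y))\<^sup>2)
      + (\<Sum>l<N. (d l)\<^sup>2 * (cmod (tri n N T (\<lambda>b. cnj (G l b)) (V j) z))\<^sup>2)) / 2))"
    by (intro sum_mono mult_left_mono divide_right_mono add_mono main \<xi>0) simp
  also have "\<dots> = (\<Sum>j<n. \<Sum>l<N. (d l)\<^sup>2 * \<xi> j * (((cmod (tri n N T (\<lambda>b. cnj (G l b)) (U j) y))\<^sup>2 +
      (cmod (tri n N T (\<lambda>b. cnj (G l b)) (V j) z))\<^sup>2) / 2))"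
    unfolding sum.distrib [symmetric] sum_divide_distrib sum_distrib_left
    by (intro sum.cong refl) (simp add: algebra_simps add_divide_distrib)
  finally show ?thesis unfolding y_def z_def by (subst sum.swap)
qed

section \<open>Exponent arithmetic and the Schatten norm estimate\<close>

lemma ereal_inv_nonneg: "1 \<le> p \<Longrightarrow> 0 \<le> ereal_inv p"
  by (cases p) (auto simp: ereal_inv_def)

lemma ereal_inv_le_1: "1 \<le> p \<Longrightarrow> ereal_inv p \<le> 1"
  by (cases p) (auto simp: ereal_inv_def one_ereal_def)

lemma ereal_inv_antimono: "1 \<le> p \<Longrightarrow> p \<le> q \<Longrightarrow> ereal_inv q \<le> ereal_inv p"
  by (cases p; cases q) (auto simp: ereal_inv_def one_ereal_def frac_le)

text \<open>Monotonicity of the reciprocal puts \<open>d\<close> into the interval from 0 to 1. For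
  \<open>d = 0\<close> the exponent is \<open>\<infinity>\<close>, whose \<open>ereal_inv\<close> is
  0, so the identity persists.\<close>

lemma r_exp_facts:
  assumes "1 \<le> p" "p \<le> q"
  shows "1 \<le> r_exp p q" "2 * ereal_inv (r_exp p q) = ereal_inv q - ereal_inv p + 1"
proof -
  define d where "d = ereal_inv q - ereal_inv p + 1"
  have d: "0 \<le> d" "d \<le> 1"
    using ereal_inv_nonneg[OF order_trans[OF assms]] ereal_inv_le_1[OF assms(1)] ereal_inv_antimono[OF assms]
    by (simp_all add: d_def)
  show "1 \<le> r_exp p q" "2 * ereal_inv (r_exp p q) = ereal_inv q - ereal_inv p + 1"
    using d unfolding r_exp_def d_def[symmetric] Let_def
    by (auto simp: ereal_inv_def one_ereal_def field_simps)
qed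

text \<open>By duality it suffices to pair the singular values of the image with \<open>Y\<close>.
  Replacing those of \<open>a\<close> and \<open>x\<close> by powers of summable weights
  \<open>E\<close> and \<open>X\<close> turns the bound of \<open>singular_value_rho_le\<close> into
  the sum treated by \<open>trilinear_Young\<close> with constant \<open>c\<^sup>2\<close>.\<close>

lemma schatten_rho_le:
  assumes p: "1 \<le> p" and pq: "p \<le> q" and c: "0 \<le> c" and L: "0 \<le> L" and m: "m \<le> N"
    and a: "schatten (r_exp p q) N a \<le> L"
    and T: "\<And>v. vnorm N v = 1 \<Longrightarrow> opnorm n (\<lambda>i k. \<Sum>b<N. v b * T b i k) \<le> c"
    and S: "\<And>h i j. h < m \<Longrightarrow> i < n \<Longrightarrow> j < n \<Longrightarrow> S h i j = (\<Sum>b<N. a h b * T b i j)"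
    and x: "schatten p n x \<le> 1"
  shows "schatten q n (rho n m S x) \<le> (L * c)\<^sup>2"
proof (rule schatten_le_dual)
  show q: "1 \<le> q" using p pq by simp
  show "0 \<le> (L * c)\<^sup>2" by simp
  fix P W :: cmatrix and s Y :: "nat \<Rightarrow> real"
  assume Z: "is_svd n (rho n m S x) P s W" and Y: "\<And>k. 0 \<le> Y k" "(\<Sum>k<n. Y k) \<le> 1"
  obtain F d G E where svd_a: "is_svd N a F d G" and E: "\<And>k. 0 \<le> E k" "(\<Sum>k<N. E k) \<le> 1"
    and dE: "\<And>l. l < N \<Longrightarrow> d l \<le> L * E l powr ereal_inv (r_exp p q)"
    by (rule schatten_weights[OF r_exp_facts(1)[OF p pq] L a]) (rule that)
  obtain U \<xi> V X where svd_x: "is_svd n x U \<xi> V" and X: "\<And>k. 0 \<le> X k" "(\<Sum>k<n. X k) \<le> 1"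
    and xX: "\<And>j. j < n \<Longrightarrow> \<xi> j \<le> 1 * X j powr ereal_inv p"
    by (rule schatten_weights[OF p zero_le_one x]) (rule that)
  \<comment> \<open>These are \<open>2 / r\<close>, \<open>1 / p\<close> and
    \<open>1 - 1 / q\<close>; the bound \<open>\<alpha> \<le> 1\<close> follows from
    \<open>p \<le> q\<close>.\<close>
  define \<alpha> \<beta> \<gamma> where "\<alpha> = ereal_inv q - ereal_inv p + 1" and "\<beta> = ereal_inv p" and "\<gamma> = 1 - ereal_inv q"
  have exps: "\<alpha> \<le> 1" "\<beta> \<le> 1" "\<gamma> \<le> 1" "\<alpha> + \<beta> + \<gamma> = 2"
    using ereal_inv_nonneg[OF q] ereal_inv_le_1[OF p] ereal_inv_antimono[OF p pq]
    by (auto simp: \<alpha>_def \<beta>_def \<gamma>_def)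
  define K where "K = (\<lambda>l j k.
    ((cmod (tri n N T (\<lambda>b. cnj (G l b)) (U j) (\<lambda>i. cnj (P k i))))\<^sup>2 +
      (cmod (tri n N T (\<lambda>b. cnj (G l b)) (V j) (\<lambda>i. cnj (W k i))))\<^sup>2) / 2)"
  have cf: "contractive_family N (\<lambda>l b. cnj (G l b))" "contractive_family n U" "contractive_family n V"
    "contractive_family n (\<lambda>k i. cnj (P k i))" "contractive_family n (\<lambda>k i. cnj (W k i))"
    using svd_a svd_x Z by (auto simp: is_svd_def intro: contractive_family_cnj)
  note mem = cf[THEN contractive_family_member]
  have bound: "cmod (tri n N T v u y) \<le> c * vnorm N v * vnorm n u * vnorm n y" for v u y
    using T by (rule tri_le)
  note sums = tri_sum_left[of c n N T, OF c bound cf(1)] tri_sum_middle[of c n N T, OF c bound]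
    tri_sum_right[of c n N T, OF c bound]
  have K0: "0 \<le> K l j k" for l j k by (simp add: K_def)
  have half: "(\<Sum>i\<in>A. (f i + g i) / 2) \<le> c\<^sup>2" if "(\<Sum>i\<in>A. f i) \<le> c\<^sup>2" "(\<Sum>i\<in>A. g i) \<le> c\<^sup>2"
    for A :: "nat set" and f g :: "nat \<Rightarrow> real"
    using that by (simp add: sum.distrib flip: sum_divide_distrib)
  have K1: "(\<Sum>l<N. K l j k) \<le> c\<^sup>2" if "j < n" "k < n" for j k
    unfolding K_def by (intro half sums mem that)
  have K2: "(\<Sum>j<n. K l j k) \<le> c\<^sup>2" if "l < N" "k < n" for l k
    unfolding K_def by (intro half sums mem that cf)
  have K3: "(\<Sum>k<n. K l j k) \<le> c\<^sup>2" if "l < N" "j < n" for l j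
    unfolding K_def by (intro half sums mem that cf)
  have d0: "0 \<le> d l" and \<xi>0: "0 \<le> \<xi> j" for l j using svd_a svd_x by (auto simp: is_svd_def)
  \<comment> \<open>Squaring doubles the exponent \<open>1 / r\<close> of the weight, which produces
    \<open>\<alpha>\<close>.\<close>
  have d2: "(d l)\<^sup>2 \<le> L\<^sup>2 * E l powr \<alpha>" if "l < N" for l
  proof -
    have "(d l)\<^sup>2 \<le> (L * E l powr ereal_inv (r_exp p q))\<^sup>2"
      by (intro power_mono dE that d0)
    also have "\<dots> = L\<^sup>2 * E l powr (ereal_inv (r_exp p q) + ereal_inv (r_exp p q))"
      by (simp only: powr_add power2_eq_square mult_ac)
    also have "ereal_inv (r_exp p q) + ereal_inv (r_exp p q) = \<alpha>"
      using r_exp_facts(2)[OF p pq] by (simp add: \<alpha>_def)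
    finally show ?thesis .
  qed
  have "(\<Sum>k<n. s k * Y k powr \<gamma>) \<le> (\<Sum>k<n. (\<Sum>l<N. \<Sum>j<n. (d l)\<^sup>2 * \<xi> j * K l j k) * Y k powr \<gamma>)"
    unfolding K_def
    by (intro sum_mono mult_right_mono singular_value_rho_le[OF svd_a svd_x Z m]) (auto simp: S)
  also have "\<dots> \<le> (\<Sum>k<n. (\<Sum>l<N. \<Sum>j<n. (L\<^sup>2 * E l powr \<alpha>) * X j powr \<beta> * K l j k) * Y k powr \<gamma>)"
    using xX unfolding \<beta>_def
    by (intro sum_mono mult_right_mono mult_mono d2 K0 \<xi>0) auto
  also have "\<dots> = L\<^sup>2 * (\<Sum>k<n. \<Sum>l<N. \<Sum>j<n. K l j k * (E l powr \<alpha> * X j powr \<beta> * Y k powr \<gamma>))"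
    by (simp add: sum_distrib_left sum_distrib_right mult_ac)
  also have "(\<Sum>k<n. \<Sum>l<N. \<Sum>j<n. K l j k * (E l powr \<alpha> * X j powr \<beta> * Y k powr \<gamma>))
    = (\<Sum>l<N. \<Sum>j<n. \<Sum>k<n. K l j k * (E l powr \<alpha> * X j powr \<beta> * Y k powr \<gamma>))"
    by (subst sum.swap) (intro sum.cong refl sum.swap)
  also have "L\<^sup>2 * \<dots> \<le> L\<^sup>2 * c\<^sup>2"
    by (intro mult_left_mono trilinear_Young K0 K1 K2 K3 E X Y exps) auto
  finally show "(\<Sum>k<n. s k * Y k powr (1 - ereal_inv q)) \<le> (L * c)\<^sup>2"
    by (simp add: \<gamma>_def power_mult_distrib)
qed

section \<open>Passage to the matrix norms and the cb-norm\<close>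

lemma min_norm_nonneg: "0 \<le> min_norm n T"
proof -
  \<comment> \<open>For \<open>m = 0\<close> there are no unit vectors and the inner supremum is
    that of the empty set, \<open>-\<infinity>\<close>. The case \<open>m = 1\<close> with the
    scalar 1 supplies a nonnegative member.\<close>
  have "vnorm 1 (\<lambda>_. 1) = 1" by (simp add: vnorm_def)
  then have "ereal (opnorm n (\<lambda>i j. \<Sum>k<1. 1 * T k i j)) \<le> min_norm n T"
    unfolding min_norm_def by (intro SUP_upper2[of 1] SUP_upper2[of "\<lambda>_. 1"]) auto
  moreover have "0 \<le> ereal (opnorm n (\<lambda>i j. \<Sum>k<1. 1 * T k i j))" by simp
  ultimately show ?thesis by (rule order_trans[rotated])
qed

text \<open>A finite bound on the truncations excludes the infinite branch of
  \<open>pq_norm\<close>; on the other branch the square root undoes the square of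
  \<open>B\<close>.\<close>

lemma pq_norm_le:
  assumes B: "0 \<le> B" and le: "\<And>m x. schatten p n x \<le> 1 \<Longrightarrow> schatten q n (rho n m S x) \<le> B\<^sup>2"
  shows "pq_norm p q n S \<le> ereal B"
proof -
  define s where "s = (SUP m. pq_sq_trunc p q n m S)"
  have s: "s \<le> ereal (B\<^sup>2)"
    unfolding s_def pq_sq_trunc_def by (intro SUP_least) (simp add: le)
  then have "s \<noteq> \<infinity>" by auto
  moreover have "real_of_ereal s \<le> B\<^sup>2" using s by (cases s) auto
  then have "sqrt (real_of_ereal s) \<le> B" using B by (intro real_le_lsqrt) auto
  ultimately show ?thesis unfolding pq_norm_def s_def[symmetric] Let_def by simp
qed

theorem theorem4p4:
  fixes p q :: ereal and a :: cmatrix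
  assumes "1 \<le> p" and "p \<le> q"
    and "in_schatten (r_exp p q) a"
  shows "cb_norm_min_pq p q a \<le> op_schatten (r_exp p q) a"
proof -
  let ?r = "r_exp p q"
  have upper: "ereal (schatten ?r N a) \<le> op_schatten ?r a" for N
    unfolding op_schatten_def by (rule SUP_upper) simp
  have nonneg: "0 \<le> op_schatten ?r a"
    using upper[of 0] schatten_nonneg[of ?r 0 a] by (metis ereal_less_eq(5) order_trans)
  moreover have "op_schatten ?r a < \<infinity>" using assms(3) by (simp add: in_schatten_def)
  ultimately obtain L where L: "op_schatten ?r a = ereal L" "0 \<le> L"
    by (cases "op_schatten ?r a") auto
  have "pq_norm p q n (op_apply a T) / min_norm n T \<le> op_schatten ?r a"
    if supp: "fin_supp T" and nz: "min_norm n T \<noteq> 0" for n T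
  proof (cases "min_norm n T")
    case (real c)
    then have c: "c > 0" using min_norm_nonneg[of n T] nz by (simp add: zero_ereal_def)
    obtain N0 where N0: "{k. T k \<noteq> (\<lambda>i j. 0)} \<subseteq> {..<N0}"
      using supp finite_nat_iff_bounded unfolding fin_supp_def by blast
    have "pq_norm p q n (op_apply a T) \<le> ereal (L * c)"
    proof (rule pq_norm_le)
      fix m x assume x: "schatten p n x \<le> 1"
      \<comment> \<open>Large enough for the section of \<open>a\<close> to contain the
        \<open>m\<close> rows that occur and for \<open>{..<N}\<close> to contain the support of
        \<open>T\<close>.\<close>
      define N where "N = max m N0"
      show "schatten q n (rho n m (op_apply a T) x) \<le> (L * c)\<^sup>2"
      proof (rule schatten_rho_le[OF assms(1,2) _ L(2) _ _ _ _ x])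
        show "0 \<le> c" using c by simp
        show "m \<le> N" by (simp add: N_def)
        show "schatten ?r N a \<le> L" using upper[of N] L by simp
        show "opnorm n (\<lambda>i k. \<Sum>b<N. v b * T b i k) \<le> c" if "vnorm N v = 1" for v
        proof -
          have "ereal (opnorm n (\<lambda>i k. \<Sum>b<N. v b * T b i k)) \<le> min_norm n T"
            unfolding min_norm_def using that
            by (intro SUP_upper2[of N] SUP_upper2[of v]) auto
          then show ?thesis using real by simp
        qed
        show "op_apply a T h i j = (\<Sum>b<N. a h b * T b i j)" for h i j
          unfolding op_apply_def using N0 by (intro sum.mono_neutral_left) (auto simp: N_def)
      qed
    qed (use c L in simp)
    then have "pq_norm p q n (op_apply a T) \<le> ereal c * ereal L" by (simp add: mult.commute)
    then show ?thesis using c unfolding real L by (subst ereal_divide_le_pos) auto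
  next
    \<comment> \<open>Division by \<open>\<infinity>\<close> gives 0 in \<open>ereal\<close>, so
      only nonnegativity of the right side is required.\<close>
    case PInf
    then show ?thesis using nonneg by simp
  next
    case MInf
    then show ?thesis using min_norm_nonneg[of n T] by simp
  qed
  then show ?thesis unfolding cb_norm_min_pq_def by (intro SUP_least) auto
qed

end
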